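(* There are a computable function $f$ and an algorithm that, given a finite simple connected undirected graph $G$ and a set $X\subseteq V(G)$ of size $d$ such that $G\setminus X$ is a threshold graph, runs in time $f(d)\cdot|V(G)|^{O(1)}$ and finds a conflict-free closed neighborhood coloring of $G$ with $k$ colors, for some $k$ satisfying $\chi_{cf}[G]\le k\le \chi_{cf}[G]+1$.
   Context: A threshold graph is a graph that can be constructed recursively (starting from a single vertex) by repeatedly adding an isolated vertex or a universal vertex (a vertex adjacent to all other current vertices). $G\setminus X$ is the graph obtained from $G$ by deleting the vertices of $X$. Let $N[v]$ be the closed neighborhood of $v$. For a coloring $C_G:V(G)\to\{1,\dots,k\}$ (not necessarily proper), a set $U\subseteq V(G)$ has a unique color if there is a color $c$ with $|\{u\in U: C_G(u)=c\}|=1$. The coloring is a conflict-free closed neighborhood (CF-CN) coloring if $N[v]$ has a unique color for every $v\in V(G)$. $\chi_{cf}[G]$ denotes the minimum number of colors in a CF-CN coloring of $G$. *)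

theory Defs
  imports "Graph_Theory.Digraph_Component" "Graph_Theory.Pair_Digraph"
begin

section \<open>Graphs and conflict-free colorings\<close>

text \<open>
  A finite simple undirected graph is a \<^locale>\<open>pair_graph\<close>: a finite loop-free digraph
  without parallel arcs whose arc set is symmetric, each edge being a pair of opposite arcs.
\<close>

definition delete_verts :: "'a pair_pre_digraph \<Rightarrow> 'a set \<Rightarrow> 'a pair_pre_digraph" where
  "delete_verts G X =
     \<lparr>pverts = pverts G - X, parcs = {(u, v) \<in> parcs G. u \<notin> X \<and> v \<notin> X}\<rparr>"

inductive threshold_graph :: "'a pair_pre_digraph \<Rightarrow> bool" where
  single: "threshold_graph \<lparr>pverts = {v}, parcs = {}\<rparr>"
| isolated: "threshold_graph H \<Longrightarrow> v \<notin> pverts H \<Longrightarrow>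
    threshold_graph \<lparr>pverts = insert v (pverts H), parcs = parcs H\<rparr>"
| universal: "threshold_graph H \<Longrightarrow> v \<notin> pverts H \<Longrightarrow>
    threshold_graph \<lparr>pverts = insert v (pverts H),
                     parcs = parcs H \<union> {v} \<times> pverts H \<union> pverts H \<times> {v}\<rparr>"

definition closed_nbhd :: "'a pair_pre_digraph \<Rightarrow> 'a \<Rightarrow> 'a set" where
  "closed_nbhd G v = insert v {u. (v, u) \<in> parcs G}"

definition has_unique_color :: "('a \<Rightarrow> nat) \<Rightarrow> 'a set \<Rightarrow> bool" where
  "has_unique_color C U \<longleftrightarrow> (\<exists>c. card {u \<in> U. C u = c} = 1)"

definition cf_cn_coloring :: "'a pair_pre_digraph \<Rightarrow> nat \<Rightarrow> ('a \<Rightarrow> nat) \<Rightarrow> bool" where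
  "cf_cn_coloring G k C \<longleftrightarrow>
     C ` pverts G \<subseteq> {1..k} \<and> (\<forall>v \<in> pverts G. has_unique_color C (closed_nbhd G v))"

definition chi_cf :: "'a pair_pre_digraph \<Rightarrow> nat" where
  "chi_cf G = (LEAST k. \<exists>C. cf_cn_coloring G k C)"

section \<open>Algorithms and running time\<close>

text \<open>
  Algorithms are structured programs for a random access machine with unit costs whose only
  arithmetic operations are addition and truncated subtraction. Without multiplication, numbers
  gain only a constant number of bits per step, so running times agree with those of Turing
  machines up to a polynomial.

  The memory consists of named arrays of natural numbers; \<open>s a i\<close> is the content of cell \<open>i\<close> of
  array \<open>a\<close>, and cell \<open>0\<close> serves as a scalar variable. A program mentions only finitely many
  arrays, which could be interleaved in a single one.
\<close>

type_synonym mem = "string \<Rightarrow> nat \<Rightarrow> nat"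

datatype exp = Const nat | Cell string exp | Add exp exp | Sub exp exp

primrec val :: "exp \<Rightarrow> mem \<Rightarrow> nat" where
  "val (Const n) s = n"
| "val (Cell a e) s = s a (val e s)"
| "val (Add e e') s = val e s + val e' s"
| "val (Sub e e') s = val e s - val e' s"

text \<open>\<open>Assign a e e'\<close> writes the value of \<open>e'\<close> to cell \<open>e\<close> of array \<open>a\<close>; a test succeeds iff its
  expression is nonzero.\<close>

datatype com = Skip | Assign string exp exp | Seq com com | Cond exp com com | While exp com

text \<open>
  \<open>exec p s t s'\<close>: started in \<open>s\<close>, the program \<open>p\<close> halts in \<open>s'\<close> after \<open>t\<close> steps. Evaluating an
  expression is part of the step that uses it: for a fixed program this takes boundedly many
  elementary operations.
\<close>

inductive exec :: "com \<Rightarrow> mem \<Rightarrow> nat \<Rightarrow> mem \<Rightarrow> bool" where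
  Skip: "exec Skip s 1 s"
| Assign: "exec (Assign a e e') s 1 (s(a := (s a)(val e s := val e' s)))"
| Seq: "exec p s t s' \<Longrightarrow> exec q s' t' s'' \<Longrightarrow> exec (Seq p q) s (t + t') s''"
| CondTrue: "val e s \<noteq> 0 \<Longrightarrow> exec p s t s' \<Longrightarrow> exec (Cond e p q) s (Suc t) s'"
| CondFalse: "val e s = 0 \<Longrightarrow> exec q s t s' \<Longrightarrow> exec (Cond e p q) s (Suc t) s'"
| WhileFalse: "val e s = 0 \<Longrightarrow> exec (While e p) s 1 s"
| WhileTrue: "val e s \<noteq> 0 \<Longrightarrow> exec p s t s' \<Longrightarrow> exec (While e p) s' t' s'' \<Longrightarrow>
    exec (While e p) s (Suc (t + t')) s''"

inductive_cases SkipE: "exec Skip s t s'"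
  and AssignE: "exec (Assign a e e') s t s'"
  and SeqE: "exec (Seq p q) s t s'"
  and CondE: "exec (Cond e p q) s t s'"
  and WhileE: "exec (While e p) s t s'"

lemma exec_deterministic: "exec p s t s' \<Longrightarrow> exec p s u r \<Longrightarrow> u = t \<and> r = s'"
proof (induction arbitrary: u r rule: exec.induct)
  case (Skip s)
  then show ?case by (rule SkipE) simp
next
  case (Assign a e e' s)
  then show ?case by (rule AssignE) simp
next
  case (Seq p s t s' q t' s'')
  from Seq.prems show ?case by (rule SeqE) (auto dest: Seq.IH)
next
  case (CondTrue e s p t s' q)
  from CondTrue.prems show ?case by (rule CondE) (use CondTrue.hyps in \<open>auto dest: CondTrue.IH\<close>)
next
  case (CondFalse e s q t s' p)
  from CondFalse.prems show ?case by (rule CondE) (use CondFalse.hyps in \<open>auto dest: CondFalse.IH\<close>)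
next
  case (WhileFalse e s p)
  from WhileFalse.prems show ?case by (rule WhileE) (use WhileFalse in auto)
next
  case (WhileTrue e s p t s' t' s'')
  from WhileTrue.prems show ?case by (rule WhileE) (use WhileTrue.hyps in \<open>auto dest: WhileTrue.IH\<close>)
qed

definition computable :: "(nat \<Rightarrow> nat) \<Rightarrow> bool" where
  "computable f \<longleftrightarrow>
     (\<exists>p. \<forall>n. \<exists>t s. exec p ((\<lambda>a i. 0)(''in'' := (\<lambda>i. 0)(0 := n))) t s \<and> s ''out'' 0 = f n)"

text \<open>
  The input \<open>(G, X)\<close>, where \<open>G\<close> has vertex set \<open>{..<n}\<close>, is given by the number \<open>n\<close>, the
  adjacency matrix of \<open>G\<close> stored row by row, and the characteristic vector of \<open>X\<close>.
\<close>

definition graph_input :: "nat \<Rightarrow> nat pair_pre_digraph \<Rightarrow> nat set \<Rightarrow> mem" where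
  "graph_input n G X = (\<lambda>a i. 0)
     (''n'' := (\<lambda>i. 0)(0 := n),
      ''adj'' := (\<lambda>i. if i < n * n \<and> (i div n, i mod n) \<in> parcs G then 1 else 0),
      ''X'' := (\<lambda>i. if i \<in> X then 1 else 0))"

end

theory Submission
  imports Defs
begin

text \<open>
  In the threshold graph \<open>G - X\<close> some vertex \<open>w\<close> is adjacent to all other non-isolated vertices. Giving
  \<open>w\<close> a color of its own costs one extra color and settles every vertex of \<open>N[w]\<close>. With
  \<open>Y = X \<union> {w}\<close>, a vertex outside \<open>Y\<close> and \<open>N[w]\<close> sees nothing but itself and \<open>Y\<close>, so that vertices
  outside \<open>Y\<close> with the same neighbors in \<open>Y\<close> become interchangeable. The vertices of \<open>Y\<close> need at most
  \<open>|Y|\<close> vertices as witnesses of their unique colors, hence all but the first \<open>|Y|\<close> vertices of each of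
  the \<open>2 ^ |Y|\<close> classes may be recolored alike. As \<open>\<chi>\<close> is at most \<open>|Y| + 1\<close>, only a number of colorings
  bounded in terms of \<open>|X|\<close> remains, and these are tried with 1, 2, ... colors.
\<close>

section \<open>Reduced colorings\<close>

text \<open>Recoloring surplus twins in place could destroy unique colors seen from
  \<open>Y\<close>. The new coloring is therefore a composition \<open>C1 \<circ> g\<close>: each
  vertex outside \<open>Y\<close> takes the color of a twin picked by \<open>g\<close>, every
  witness is picked exactly once, and all vertices of high rank in a class pick the same twin. A
  vertex outside \<open>Y\<close> that does not see \<open>w\<close> then sees a copy of what its
  picked twin saw before, so the color of \<open>w\<close> is the only extra one. Adjacency between
  two vertices outside \<open>Y\<close> matters only to neighborhoods that contain \<open>w\<close>,
  and these are settled by that color.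

  The search knows neither \<chi> nor a target coloring. It stops at the first conflict-free
  coloring, so at least \<chi> colors are used by minimality; it stops with at most \<chi> + 1
  because a reduced coloring with \<chi> + 1 colors has a code that the search would reach. With
  \<open>d = card X\<close> there are at most \<open>d + 3\<close> colors on roughly
  \<open>2 ^ (d + 1) * (d + 2)\<close> free vertices, which makes the bound doubly exponential in
  \<open>d\<close>.\<close>

lemma has_unique_color_iff:
  "has_unique_color C U \<longleftrightarrow> (\<exists>u\<in>U. \<forall>z\<in>U. C z = C u \<longrightarrow> z = u)"
proof
  assume "has_unique_color C U"
  then obtain c where "card {u \<in> U. C u = c} = 1"
    unfolding has_unique_color_def by blast
  then obtain u where u: "{u \<in> U. C u = c} = {u}"
    by (auto simp: card_1_singleton_iff)
  then have "u \<in> U" "C u = c"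
    by auto
  moreover from this u have "\<forall>z\<in>U. C z = C u \<longrightarrow> z = u"
    by blast
  ultimately show "\<exists>u\<in>U. \<forall>z\<in>U. C z = C u \<longrightarrow> z = u"
    by blast
next
  assume "\<exists>u\<in>U. \<forall>z\<in>U. C z = C u \<longrightarrow> z = u"
  then obtain u where "u \<in> U" "\<forall>z\<in>U. C z = C u \<longrightarrow> z = u"
    by blast
  then have "{z \<in> U. C z = C u} = {u}"
    by auto
  then show "has_unique_color C U"
    unfolding has_unique_color_def by (auto intro!: exI[of _ "C u"])
qed

lemma has_unique_color_cong: "(\<And>u. u \<in> U \<Longrightarrow> C u = C' u) \<Longrightarrow> has_unique_color C U = has_unique_color C' U"
  by (auto simp: has_unique_color_iff)

definition twins :: "nat pair_pre_digraph \<Rightarrow> nat set \<Rightarrow> nat \<Rightarrow> nat \<Rightarrow> bool" where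
  "twins G Y u v \<longleftrightarrow> u \<in> pverts G - Y \<and> v \<in> pverts G - Y \<and> closed_nbhd G u \<inter> Y = closed_nbhd G v \<inter> Y"

lemma twins_sym: "twins G Y u v \<Longrightarrow> twins G Y v u"
  by (simp add: twins_def)

lemma twins_trans: "twins G Y u v \<Longrightarrow> twins G Y v z \<Longrightarrow> twins G Y u z"
  by (simp add: twins_def)

definition earlier_twins :: "nat pair_pre_digraph \<Rightarrow> nat set \<Rightarrow> nat \<Rightarrow> nat set" where
  "earlier_twins G Y v = {u. u < v \<and> twins G Y u v}"

text \<open>The position of \<open>v\<close> in its class in increasing order, starting from 0.
  Vertices of \<open>Y\<close> have no twins, hence rank 0.\<close>

definition rank :: "nat pair_pre_digraph \<Rightarrow> nat set \<Rightarrow> nat \<Rightarrow> nat" where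
  "rank G Y v = card (earlier_twins G Y v)"

text \<open>Meaningful only if \<open>v\<close> has positive rank, since \<open>Max {}\<close> is unspecified.\<close>

definition prev_twin :: "nat pair_pre_digraph \<Rightarrow> nat set \<Rightarrow> nat \<Rightarrow> nat" where
  "prev_twin G Y v = Max (earlier_twins G Y v)"

text \<open>Ranks below \<open>card Y\<close> leave room for the witnesses of the vertices of
  \<open>Y\<close>, and rank \<open>card Y\<close> for a representative of the rest. Copying from
  the previous twin instead of from that representative gives the same color along the chain and
  needs only one pointer per vertex.\<close>

definition reduced :: "nat pair_pre_digraph \<Rightarrow> nat set \<Rightarrow> (nat \<Rightarrow> nat) \<Rightarrow> bool" where
  "reduced G Y C \<longleftrightarrow> (\<forall>v \<in> pverts G. card Y < rank G Y v \<longrightarrow> C v = C (prev_twin G Y v))"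

text \<open>The vertex \<open>z\<close> only expresses that \<open>u\<close> is not isolated in
  \<open>G - X\<close>.\<close>

definition dominates_outside :: "nat pair_pre_digraph \<Rightarrow> nat set \<Rightarrow> nat \<Rightarrow> bool" where
  "dominates_outside G X w \<longleftrightarrow> w \<in> pverts G - X \<and>
     (\<forall>u \<in> pverts G - X. \<forall>z \<in> pverts G - X. u \<noteq> w \<longrightarrow> (u, z) \<in> parcs G \<longrightarrow> (w, u) \<in> parcs G)"

section \<open>Dominating vertices of threshold graphs\<close>

lemma threshold_graph_arcs: "threshold_graph H \<Longrightarrow> parcs H \<subseteq> pverts H \<times> pverts H"
  by (induction rule: threshold_graph.induct) auto

text \<open>The universal vertex added last is adjacent to everything before it, and only isolated
  vertices come later. If no universal vertex was ever added, there are no arcs at all.\<close>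

lemma threshold_graph_dominating:
  assumes "threshold_graph H"
  shows "\<exists>w \<in> pverts H. \<forall>(u, z) \<in> parcs H. u \<noteq> w \<longrightarrow> (w, u) \<in> parcs H"
  using assms
proof (induction rule: threshold_graph.induct)
  case (universal H v)
  then show ?case
    using threshold_graph_arcs[OF universal.hyps(1)] by auto
qed auto

lemma ex_dominates_outside:
  assumes "threshold_graph (delete_verts G X)"
  shows "\<exists>w. dominates_outside G X w"
  using threshold_graph_dominating[OF assms] unfolding dominates_outside_def delete_verts_def by fastforce

section \<open>Ranks within a twin class, and selectors\<close>

lemma earlier_twins_finite [simp]: "finite (earlier_twins G Y v)"
  unfolding earlier_twins_def by simp

text \<open>Being twins is transitive, so below its greatest earlier member \<open>u\<close> the
  class looks the same from \<open>u\<close> and from \<open>v\<close>. This yields the recurrence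
  by which ranks are computed.\<close>

lemma earlier_twins_prev:
  assumes "u \<in> earlier_twins G Y v" and "\<And>u'. u' \<in> earlier_twins G Y v \<Longrightarrow> u' \<le> u"
  shows "earlier_twins G Y v = insert u (earlier_twins G Y u)"
proof (intro set_eqI iffI)
  have u: "u < v" "twins G Y u v"
    using assms(1) by (auto simp: earlier_twins_def)
  fix z
  show "z \<in> insert u (earlier_twins G Y u)" if z: "z \<in> earlier_twins G Y v"
  proof -
    have "z \<le> u" "twins G Y z v"
      using assms(2)[OF z] z by (auto simp: earlier_twins_def)
    then show ?thesis
      using twins_trans[OF _ twins_sym[OF u(2)]] by (auto simp: earlier_twins_def)
  qed
  show "z \<in> earlier_twins G Y v" if "z \<in> insert u (earlier_twins G Y u)"
    using that u twins_trans[OF _ u(2)] by (auto simp: earlier_twins_def)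
qed

lemma rank_prev:
  assumes "u \<in> earlier_twins G Y v" and "\<And>u'. u' \<in> earlier_twins G Y v \<Longrightarrow> u' \<le> u"
  shows "rank G Y v = Suc (rank G Y u)"
proof -
  have "u \<notin> earlier_twins G Y u"
    by (simp add: earlier_twins_def)
  then show ?thesis
    using earlier_twins_prev[OF assms] by (simp add: rank_def)
qed

lemma prev_twin_in: "0 < rank G Y v \<Longrightarrow> prev_twin G Y v \<in> earlier_twins G Y v"
  unfolding rank_def prev_twin_def by (metis Max_in card_gt_0_iff)

lemma rank_prev_twin: "0 < rank G Y v \<Longrightarrow> rank G Y v = Suc (rank G Y (prev_twin G Y v))"
  by (rule rank_prev[OF prev_twin_in]) (auto simp: prev_twin_def)

lemma rank_less:
  assumes "twins G Y u v" "u < v"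
  shows "rank G Y u < rank G Y v"
  unfolding rank_def
proof (rule psubset_card_mono)
  have "u \<in> earlier_twins G Y v" "u \<notin> earlier_twins G Y u"
    using assms by (auto simp: earlier_twins_def)
  moreover have "earlier_twins G Y u \<subseteq> earlier_twins G Y v"
    using assms(2) twins_trans[OF _ assms(1)] by (auto simp: earlier_twins_def)
  ultimately show "earlier_twins G Y u \<subset> earlier_twins G Y v"
    by blast
qed simp

lemma rank_inj:
  assumes "twins G Y u v" "rank G Y u = rank G Y v"
  shows "u = v"
proof (rule ccontr)
  assume "u \<noteq> v"
  moreover have "twins G Y v u"
    by (rule twins_sym[OF assms(1)])
  ultimately show False
    using assms rank_less by (metis linorder_neqE_nat nat_neq_iff)
qed

text \<open>Ranks are injective on the class, and each counts a proper subset of it. By cardinality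
  they fill the whole initial segment.\<close>

lemma rank_surj:
  assumes "finite (pverts G)" "v \<in> pverts G - Y" "i < card {u. twins G Y u v}"
  shows "\<exists>u. twins G Y u v \<and> rank G Y u = i"
proof -
  let ?T = "{u. twins G Y u v}"
  have fin: "finite ?T"
    using assms(1) by (rule rev_finite_subset) (auto simp: twins_def)
  have "inj_on (rank G Y) ?T"
    by (rule inj_onI, rule rank_inj) (auto intro: twins_sym twins_trans)
  then have "card (rank G Y ` ?T) = card ?T"
    by (rule card_image)
  moreover have "rank G Y ` ?T \<subseteq> {..<card ?T}"
  proof
    fix r assume "r \<in> rank G Y ` ?T"
    then obtain u where u: "u \<in> ?T" "r = rank G Y u" by blast
    have "u \<notin> earlier_twins G Y u" "earlier_twins G Y u \<subseteq> ?T"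
      using u(1) by (auto simp: earlier_twins_def intro: twins_trans)
    then have "earlier_twins G Y u \<subset> ?T"
      using u(1) by blast
    then show "r \<in> {..<card ?T}"
      using u(2) fin by (simp add: rank_def psubset_card_mono)
  qed
  ultimately have "rank G Y ` ?T = {..<card ?T}"
    by (intro card_subset_eq) auto
  then show ?thesis
    using assms(3) by (metis (no_types, lifting) imageE lessThan_iff mem_Collect_eq)
qed

text \<open>Let the members of rank below \<open>card (W \<inter> T)\<close> enumerate
  \<open>W \<inter> T\<close>, and send all others to one member outside \<open>W\<close>. As
  \<open>card (W \<inter> T) \<le> D\<close>, members of rank at least \<open>D\<close> belong to
  the others.\<close>

lemma selector_on_class:
  assumes fin: "finite (pverts G)" and v: "v \<in> pverts G - Y"
    and W: "finite W" "card W \<le> D"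
  defines "T \<equiv> {u. twins G Y u v}"
  shows "\<exists>h. (\<forall>u\<in>T. h u \<in> T) \<and> (\<forall>y \<in> W \<inter> T. \<exists>!u. u \<in> T \<and> h u = y) \<and>
    (\<forall>u\<in>T. \<forall>u'\<in>T. D \<le> rank G Y u \<longrightarrow> D \<le> rank G Y u' \<longrightarrow> h u = h u')"
proof -
  define j where "j = card (W \<inter> T)"
  have finT: "finite T"
    unfolding T_def using fin by (rule rev_finite_subset) (auto simp: twins_def)
  obtain e where e: "bij_betw e {..<j} (W \<inter> T)"
    unfolding j_def using ex_bij_betw_nat_finite[of "W \<inter> T"] W(1) by (auto simp: atLeast0LessThan)
  have jT: "j \<le> card T"
    unfolding j_def using finT by (simp add: card_mono)
  have jD: "j \<le> D"
    unfolding j_def using W card_mono[of W "W \<inter> T"] by simp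
  define y where "y = (SOME y. y \<in> T - W)"
  have y: "y \<in> T - W" if "u \<in> T" "j \<le> rank G Y u" for u
  proof -
    have "u \<notin> earlier_twins G Y u" "earlier_twins G Y u \<subseteq> T"
      using that(1) by (auto simp: earlier_twins_def T_def intro: twins_trans)
    then have "earlier_twins G Y u \<subset> T"
      using that(1) by blast
    then have "rank G Y u < card T"
      unfolding rank_def by (rule psubset_card_mono[OF finT])
    then have "card (W \<inter> T) < card T"
      using that(2) j_def by simp
    then have "\<not> T \<subseteq> W"
      by (metis Int_absorb1 less_irrefl)
    then have "\<exists>y. y \<in> T - W"
      by blast
    then show ?thesis
      unfolding y_def by (rule someI_ex)
  qed
  define h where "h u = (if rank G Y u < j then e (rank G Y u) else y)" for u
  have "\<forall>u\<in>T. h u \<in> T"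
    using y e by (auto simp: h_def bij_betw_def)
  moreover have "\<exists>!u. u \<in> T \<and> h u = z" if z: "z \<in> W \<inter> T" for z
  proof -
    obtain i where i: "i < j" "e i = z"
      using e z by (metis bij_betw_imp_surj_on imageE lessThan_iff)
    obtain u where u: "u \<in> T" "rank G Y u = i"
      using rank_surj[OF fin v, of i] i(1) jT by (auto simp: T_def)
    show ?thesis
    proof
      show "u \<in> T \<and> h u = z"
        using u i by (simp add: h_def)
    next
      fix u'
      assume u': "u' \<in> T \<and> h u' = z"
      then have "rank G Y u' < j"
        using y[of u'] z by (force simp: h_def split: if_splits)
      moreover from this have "e (rank G Y u') = e i"
        using u' i by (simp add: h_def)
      ultimately have "rank G Y u' = i"
        using e i(1) by (metis bij_betw_def inj_onD lessThan_iff)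
      then have "rank G Y u' = rank G Y u"
        using u(2) by simp
      moreover have "twins G Y u' u"
        using u(1) conjunct1[OF u'] unfolding T_def by (blast intro: twins_sym twins_trans)
      ultimately show "u' = u"
        by (rule rank_inj[rotated])
    qed
  qed
  then have "\<forall>y \<in> W \<inter> T. \<exists>!u. u \<in> T \<and> h u = y"
    by blast
  moreover have "\<forall>u\<in>T. \<forall>u'\<in>T. D \<le> rank G Y u \<longrightarrow> D \<le> rank G Y u' \<longrightarrow> h u = h u'"
    using jD by (auto simp: h_def)
  ultimately show ?thesis
    by (intro exI[of _ h] conjI)
qed

text \<open>The selectors of the single classes are glued together, with the identity on
  \<open>Y\<close>. Since each class is mapped to itself, no vertex of another class can become a
  second preimage of a witness.\<close>

lemma ex_selector:
  assumes fin: "finite (pverts G)" and W: "finite W" "card W \<le> D" "W \<subseteq> pverts G"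
  shows "\<exists>g. (\<forall>v \<in> pverts G \<inter> Y. g v = v) \<and> (\<forall>v \<in> pverts G - Y. twins G Y (g v) v) \<and>
    (\<forall>y \<in> W. \<exists>!u. u \<in> pverts G \<and> g u = y) \<and>
    (\<forall>u v. twins G Y u v \<longrightarrow> D \<le> rank G Y u \<longrightarrow> D \<le> rank G Y v \<longrightarrow> g u = g v)"
proof -
  define T where "T v = {u. twins G Y u v}" for v
  define P where "P S h \<longleftrightarrow> (\<forall>u\<in>S. h u \<in> S) \<and> (\<forall>y \<in> W \<inter> S. \<exists>!u. u \<in> S \<and> h u = y) \<and>
    (\<forall>u\<in>S. \<forall>u'\<in>S. D \<le> rank G Y u \<longrightarrow> D \<le> rank G Y u' \<longrightarrow> h u = h u')" for S and h :: "nat \<Rightarrow> nat"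
  \<comment> \<open>Choosing from the class as a set makes all its members share one
    selector.\<close>
  define H where "H S = (SOME h. P S h)" for S
  define g where "g v = (if v \<in> Y then v else H (T v) v)" for v
  have H: "P (T v) (H (T v))" if "v \<in> pverts G - Y" for v
  proof -
    have "\<exists>h. P (T v) h"
      unfolding P_def T_def by (rule selector_on_class[OF fin that W(1,2)])
    then show ?thesis
      unfolding H_def by (rule someI_ex)
  qed
  have refl: "v \<in> T v" if "v \<in> pverts G - Y" for v
    using that by (simp add: T_def twins_def)
  have T_eq: "T u = T v" if "u \<in> T v" for u v
    using that unfolding T_def by (blast intro: twins_sym twins_trans)
  have TV: "u \<in> pverts G - Y" if "u \<in> T v" for u v
    using that unfolding T_def twins_def by auto
  have gT: "g v \<in> T v" if "v \<in> pverts G - Y" for v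
    using conjunct1[OF H[OF that, unfolded P_def]] refl[OF that] that by (simp add: g_def)
  have g_wit: "\<exists>!u. u \<in> pverts G \<and> g u = y" if "y \<in> W" for y
  proof (cases "y \<in> Y")
    case True
    have "u = y" if "u \<in> pverts G" "g u = y" for u
      using that True gT[of u] TV[of y u] by (cases "u \<in> Y") (simp_all add: g_def)
    moreover have "y \<in> pverts G" "g y = y"
      using True W(3) that by (auto simp: g_def)
    ultimately show ?thesis
      by blast
  next
    case False
    then have y: "y \<in> pverts G - Y"
      using that W(3) by auto
    have ex: "\<exists>!u. u \<in> T y \<and> H (T y) u = y"
      using conjunct1[OF conjunct2[OF H[OF y, unfolded P_def]]] refl[OF y] that by blast
    have "u \<in> pverts G \<and> g u = y \<longleftrightarrow> u \<in> T y \<and> H (T y) u = y" for u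
    proof
      assume u: "u \<in> pverts G \<and> g u = y"
      then have "u \<in> pverts G - Y"
        using False by (auto simp: g_def)
      then have "y \<in> T u"
        using gT u by auto
      then have "T u = T y"
        using T_eq by simp
      then show "u \<in> T y \<and> H (T y) u = y"
        using u refl \<open>u \<in> pverts G - Y\<close> by (auto simp: g_def)
    next
      assume u: "u \<in> T y \<and> H (T y) u = y"
      then show "u \<in> pverts G \<and> g u = y"
        using TV[of u y] T_eq[of u y] by (auto simp: g_def)
    qed
    then show ?thesis
      using ex by simp
  qed
  have g_high: "g u = g v" if "twins G Y u v" "D \<le> rank G Y u" "D \<le> rank G Y v" for u v
  proof -
    have v: "v \<in> pverts G - Y" "u \<in> T v" "u \<notin> Y"
      using that(1) by (simp_all add: T_def twins_def)
    have "H (T v) u = H (T v) v"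
      using conjunct2[OF conjunct2[OF H[OF v(1), unfolded P_def]]] refl[OF v(1)] v(2) that(2,3) by blast
    then show ?thesis
      using T_eq[OF v(2)] v by (simp add: g_def)
  qed
  show ?thesis
  proof (intro exI[of _ g] conjI ballI allI impI)
    show "g v = v" if "v \<in> pverts G \<inter> Y" for v
      using that by (simp add: g_def)
    show "twins G Y (g v) v" if "v \<in> pverts G - Y" for v
      using gT[OF that] by (simp add: T_def)
  qed (fact g_wit g_high)+
qed

text \<open>The only consequence of the threshold structure that the coloring arguments rely
  on.\<close>

definition neighborhoods_near :: "nat pair_pre_digraph \<Rightarrow> nat set \<Rightarrow> nat \<Rightarrow> bool" where
  "neighborhoods_near G Y w \<longleftrightarrow> w \<in> Y \<and>
     (\<forall>v \<in> pverts G - Y. w \<notin> closed_nbhd G v \<longrightarrow> closed_nbhd G v \<subseteq> insert v Y)"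

lemma pair_graph_facts:
  assumes "pair_graph G"
  shows "finite (pverts G)"
    and "(u, v) \<in> parcs G \<Longrightarrow> u \<in> pverts G" "(u, v) \<in> parcs G \<Longrightarrow> v \<in> pverts G"
    and "(u, v) \<in> parcs G \<Longrightarrow> (v, u) \<in> parcs G"
proof -
  interpret pair_graph G by fact
  show "finite (pverts G)"
    by (rule pair_finite_verts)
  show "(u, v) \<in> parcs G \<Longrightarrow> u \<in> pverts G" "(u, v) \<in> parcs G \<Longrightarrow> v \<in> pverts G"
    using in_arcsD1 in_arcsD2 by auto
  show "(u, v) \<in> parcs G \<Longrightarrow> (v, u) \<in> parcs G"
    using arcs_symmetric by simp
qed

text \<open>A further neighbor of \<open>v\<close> outside \<open>insert w X\<close> would make
  \<open>v\<close> non-isolated in \<open>G - X\<close>, hence adjacent to \<open>w\<close>.\<close>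

lemma dominates_outside_near:
  assumes G: "pair_graph G" and dom: "dominates_outside G X w"
  shows "neighborhoods_near G (insert w X) w"
  unfolding neighborhoods_near_def
proof (intro conjI ballI impI subsetI)
  note pg = pair_graph_facts[OF G]
  fix v z
  assume v: "v \<in> pverts G - insert w X" "w \<notin> closed_nbhd G v" and z: "z \<in> closed_nbhd G v"
  show "z \<in> insert v (insert w X)"
  proof (rule ccontr)
    assume "z \<notin> insert v (insert w X)"
    then have "(v, z) \<in> parcs G" "z \<in> pverts G - X"
      using z pg(3) by (auto simp: closed_nbhd_def)
    then have "(w, v) \<in> parcs G"
      using v dom by (auto simp: dominates_outside_def)
    then have "(v, w) \<in> parcs G"
      by (rule pg(4))
    then show False
      using v(2) by (simp add: closed_nbhd_def)
  qed
qed simp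

lemma reduced_coloring:
  assumes G: "pair_graph G" and Y: "Y \<subseteq> pverts G" and near: "neighborhoods_near G Y w"
    and C: "cf_cn_coloring G k C"
  shows "\<exists>C'. cf_cn_coloring G (k + 1) C' \<and> reduced G Y C'"
proof -
  note pg = pair_graph_facts[OF G]
  have sym: "z \<in> closed_nbhd G v \<longleftrightarrow> v \<in> closed_nbhd G z" for v z
    using pg(4) by (auto simp: closed_nbhd_def)
  have sub: "closed_nbhd G v \<subseteq> pverts G" if "v \<in> pverts G" for v
    using that pg(3) by (auto simp: closed_nbhd_def)
  have w: "w \<in> Y" "w \<in> pverts G"
    using near Y by (auto simp: neighborhoods_near_def)
  \<comment> \<open>\<open>C\<close> does not use the color \<open>k + 1\<close>, so
    \<open>w\<close> is alone with it and serves every neighborhood that contains \<open>w\<close>;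
    on the other neighborhoods \<open>C1\<close> and \<open>C\<close> agree.\<close>
  define C1 where "C1 = C(w := k + 1)"
  have C1_range: "C1 v \<in> {1..k + 1}" if "v \<in> pverts G" for v
    using C that by (fastforce simp: cf_cn_coloring_def C1_def)
  have C1_w: "C1 v = k + 1 \<longleftrightarrow> v = w" if "v \<in> pverts G" for v
  proof -
    have "C v \<in> {1..k}"
      using C that by (auto simp: cf_cn_coloring_def)
    then show ?thesis
      by (auto simp: C1_def)
  qed
  have C1: "has_unique_color C1 (closed_nbhd G v)" if v: "v \<in> pverts G" for v
  proof (cases "w \<in> closed_nbhd G v")
    case True
    moreover have "z = w" if "z \<in> closed_nbhd G v" "C1 z = C1 w" for z
      using C1_w[of z] C1_w[of w] w(2) sub[OF v] that by auto
    ultimately show ?thesis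
      unfolding has_unique_color_iff by blast
  next
    case False
    then have "has_unique_color C1 (closed_nbhd G v) = has_unique_color C (closed_nbhd G v)"
      by (intro has_unique_color_cong) (auto simp: C1_def)
    then show ?thesis
      using C v by (simp add: cf_cn_coloring_def)
  qed
  have "\<forall>x\<in>Y. \<exists>u \<in> closed_nbhd G x. \<forall>z \<in> closed_nbhd G x. C1 z = C1 u \<longrightarrow> z = u"
    using C1 Y by (auto simp: has_unique_color_iff)
  \<comment> \<open>One witness for each vertex of \<open>Y\<close>, hence at most
    \<open>card Y\<close> witnesses in total. Only these have to survive.\<close>
  then obtain wit where wit: "\<And>x. x \<in> Y \<Longrightarrow> wit x \<in> closed_nbhd G x"
      "\<And>x z. x \<in> Y \<Longrightarrow> z \<in> closed_nbhd G x \<Longrightarrow> C1 z = C1 (wit x) \<Longrightarrow> z = wit x"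
    by metis
  have finY: "finite Y"
    using Y pg(1) by (rule finite_subset)
  have W: "finite (wit ` Y)" "card (wit ` Y) \<le> card Y"
    using finY card_image_le by auto
  have W': "wit ` Y \<subseteq> pverts G"
  proof
    fix y assume "y \<in> wit ` Y"
    then obtain x where "x \<in> Y" "y = wit x"
      by blast
    then show "y \<in> pverts G"
      using wit(1)[of x] sub[of x] Y by blast
  qed
  obtain g where g: "\<forall>v \<in> pverts G \<inter> Y. g v = v" "\<forall>v \<in> pverts G - Y. twins G Y (g v) v"
      "\<forall>y \<in> wit ` Y. \<exists>!u. u \<in> pverts G \<and> g u = y"
      "\<forall>u v. twins G Y u v \<longrightarrow> card Y \<le> rank G Y u \<longrightarrow> card Y \<le> rank G Y v \<longrightarrow> g u = g v"
    using ex_selector[OF pg(1) W W', of Y] by (elim exE conjE)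
  have g_id: "g v = v" if "v \<in> Y" for v
    using g(1) that Y by blast
  note g_twins = bspec[OF g(2)] and g_wit = bspec[OF g(3)] and g_high = g(4)[rule_format]
  have g_in: "g v \<in> pverts G" if "v \<in> pverts G" for v
    using that g_id[of v] g_twins[of v] by (cases "v \<in> Y") (simp_all add: twins_def)
  have g_Y: "g v \<in> Y \<longleftrightarrow> v \<in> Y" if "v \<in> pverts G" for v
    using that g_id[of v] g_twins[of v] by (cases "v \<in> Y") (simp_all add: twins_def)
  have g_nbhd: "g v \<in> closed_nbhd G x \<longleftrightarrow> v \<in> closed_nbhd G x" if "x \<in> Y" "v \<in> pverts G" for x v
  proof (cases "v \<in> Y")
    case False
    then have "closed_nbhd G (g v) \<inter> Y = closed_nbhd G v \<inter> Y"
      using g_twins that(2) by (simp add: twins_def)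
    then have "x \<in> closed_nbhd G (g v) \<longleftrightarrow> x \<in> closed_nbhd G v"
      using that(1) by blast
    then show ?thesis
      using sym[of x "g v"] sym[of x v] by simp
  qed (simp add: g_id)
  have "has_unique_color (C1 \<circ> g) (closed_nbhd G v)" if v: "v \<in> pverts G" for v
  proof -
    consider "v \<in> Y" | "v \<notin> Y" "w \<in> closed_nbhd G v" | "v \<notin> Y" "w \<notin> closed_nbhd G v"
      by blast
    then show ?thesis
    proof cases
      \<comment> \<open>For \<open>v \<in> Y\<close>, applying \<open>g\<close> preserves membership
        in \<open>N[v]\<close>, because twins have the same neighbors in \<open>Y\<close>. The
        unique preimage of the old witness is the new one.\<close>
      case 1
      then obtain u where u: "u \<in> pverts G" "g u = wit v"
          "\<And>u'. u' \<in> pverts G \<Longrightarrow> g u' = wit v \<Longrightarrow> u' = u"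
        using g_wit[of "wit v"] by (auto elim!: ex1E)
      have "u \<in> closed_nbhd G v"
        using g_nbhd[OF 1 u(1)] wit(1)[OF 1] u(2) by simp
      moreover have "z = u" if z: "z \<in> closed_nbhd G v" "C1 (g z) = C1 (g u)" for z
      proof -
        have zV: "z \<in> pverts G"
          using z(1) sub[OF v] by auto
        then have "g z \<in> closed_nbhd G v"
          using g_nbhd[OF 1] z(1) by simp
        then have "g z = wit v"
          using wit(2)[OF 1] z(2) u(2) by simp
        then show ?thesis
          using u(3) zV by simp
      qed
      ultimately show ?thesis
        unfolding has_unique_color_iff by auto
    next
      \<comment> \<open>\<open>g\<close> fixes \<open>w\<close> and sends nothing else to it, so the
        color of \<open>w\<close> stays unique.\<close>
      case 2
      have "z = w" if z: "z \<in> closed_nbhd G v" "C1 (g z) = C1 (g w)" for z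
      proof -
        have zV: "z \<in> pverts G"
          using z(1) sub[OF v] by auto
        have "C1 (g z) = k + 1"
          using z(2) g_id[OF w(1)] by (simp add: C1_def)
        then have "g z = w"
          using C1_w[OF g_in[OF zV]] by simp
        moreover from this have "z \<in> Y"
          using g_Y[OF zV] w(1) by simp
        ultimately show ?thesis
          using g_id by simp
      qed
      then show ?thesis
        unfolding has_unique_color_iff using 2(2) by auto
    next
      \<comment> \<open>\<open>N[v]\<close> and \<open>N[g v]\<close> consist of \<open>v\<close>
        and \<open>g v\<close>, respectively, and the same vertices of \<open>Y\<close>, which
        \<open>g\<close> fixes. So \<open>g\<close> maps \<open>N[v]\<close> bijectively onto
        \<open>N[g v]\<close>, and the unique color that \<open>C1\<close> has there is pulled
        back.\<close>
      case 3
      have tw: "twins G Y (g v) v"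
        using g_twins v 3(1) by simp
      then have gv: "g v \<in> pverts G" "g v \<notin> Y" "closed_nbhd G (g v) \<inter> Y = closed_nbhd G v \<inter> Y"
        by (simp_all add: twins_def)
      then have "w \<notin> closed_nbhd G (g v)"
        using 3(2) w(1) by blast
      have split: "closed_nbhd G u = insert u (closed_nbhd G u \<inter> Y)"
        if "u \<in> pverts G - Y" "w \<notin> closed_nbhd G u" for u
        using near that by (auto simp: neighborhoods_near_def closed_nbhd_def)
      have nbhd: "closed_nbhd G (g v) = insert (g v) (closed_nbhd G v \<inter> Y)"
        using split[of "g v"] gv \<open>w \<notin> closed_nbhd G (g v)\<close> by simp
      have nbhd': "closed_nbhd G v = insert v (closed_nbhd G v \<inter> Y)"
        using split[of v] v 3 by simp
      obtain u where u: "u \<in> closed_nbhd G (g v)" "\<And>z. z \<in> closed_nbhd G (g v) \<Longrightarrow> C1 z = C1 u \<Longrightarrow> z = u"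
        using C1[OF gv(1)] by (auto simp: has_unique_color_iff)
      have img: "g z \<in> closed_nbhd G (g v)" if "z \<in> closed_nbhd G v" for z
      proof (cases "z = v")
        case False
        then have "z \<in> closed_nbhd G v \<inter> Y"
          using that nbhd' by blast
        then show ?thesis
          using g_id nbhd by auto
      qed (use nbhd in simp)
      have inj: "z = z'" if "z \<in> closed_nbhd G v" "z' \<in> closed_nbhd G v" "g z = g z'" for z z'
      proof -
        have "z = v \<or> z \<in> Y" "z' = v \<or> z' \<in> Y"
          using that(1,2) nbhd' by blast+
        then show ?thesis
          using that(3) g_id gv(2) by metis
      qed
      obtain u' where u': "u' \<in> closed_nbhd G v" "g u' = u"
      proof (cases "u = g v")
        case True
        then show ?thesis
          using that nbhd' by blast
      next
        case False
        then have "u \<in> closed_nbhd G v \<inter> Y"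
          using u(1) nbhd by blast
        then show ?thesis
          using that[of u] g_id[of u] by simp
      qed
      have "z = u'" if "z \<in> closed_nbhd G v" "C1 (g z) = C1 (g u')" for z
        using inj[OF that(1) u'(1)] u(2)[OF img[OF that(1)]] that(2) u'(2) by simp
      then show ?thesis
        unfolding has_unique_color_iff using u'(1) by auto
    qed
  qed
  moreover have "(C1 \<circ> g) ` pverts G \<subseteq> {1..k + 1}"
    using C1_range g_in by auto
  moreover have "reduced G Y (C1 \<circ> g)"
    unfolding reduced_def
  proof (intro ballI impI)
    fix v
    assume "card Y < rank G Y v"
    then have *: "prev_twin G Y v \<in> earlier_twins G Y v" "rank G Y v = Suc (rank G Y (prev_twin G Y v))"
      using prev_twin_in rank_prev_twin by auto
    \<comment> \<open>The previous twin has rank one less, which is still at least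
      \<open>card Y\<close>. This is why copying starts only above rank
      \<open>card Y\<close>.\<close>
    have "g (prev_twin G Y v) = g v"
      using * \<open>card Y < rank G Y v\<close> by (intro g_high) (auto simp: earlier_twins_def)
    then show "(C1 \<circ> g) v = (C1 \<circ> g) (prev_twin G Y v)"
      by simp
  qed
  ultimately show ?thesis
    unfolding cf_cn_coloring_def by blast
qed

section \<open>Bounds on the number of colors and of free vertices\<close>

lemma chi_cf_le: "cf_cn_coloring G k C \<Longrightarrow> chi_cf G \<le> k"
  unfolding chi_cf_def by (rule Least_le) blast

text \<open>Give the vertices of \<open>Y\<close> distinct colors and all others one further color.
  Each neighborhood meets \<open>Y\<close> in itself or in \<open>w\<close>, or else has its center
  as the only vertex outside \<open>Y\<close>.\<close>

lemma ex_coloring_near: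
  assumes G: "pair_graph G" and Y: "Y \<subseteq> pverts G" and near: "neighborhoods_near G Y w"
  shows "\<exists>C. cf_cn_coloring G (card Y + 1) C"
proof -
  note pg = pair_graph_facts[OF G]
  have "finite Y"
    using Y pg(1) by (rule finite_subset)
  then obtain e where e: "bij_betw e Y {1..card Y}"
    using finite_same_card_bij[of Y "{1..card Y}"] by auto
  have eY: "e y \<in> {1..card Y}" if "y \<in> Y" for y
    using bij_betwE[OF e] that by auto
  have inj: "y = z" if "y \<in> Y" "z \<in> Y" "e y = e z" for y z
    using e that by (auto simp: bij_betw_def inj_on_def)
  define C where "C v = (if v \<in> Y then e v else card Y + 1)" for v
  have own: "z = y" if "y \<in> Y" "C z = C y" for y z
  proof (cases "z \<in> Y")
    case False
    then show ?thesis
      using that eY[of y] by (simp add: C_def)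
  qed (use that inj[of z y] in \<open>simp add: C_def\<close>)
  have "has_unique_color C (closed_nbhd G v)" if v: "v \<in> pverts G" for v
  proof -
    have self: "v \<in> closed_nbhd G v"
      by (simp add: closed_nbhd_def)
    consider "v \<in> Y" | "w \<in> closed_nbhd G v" | "v \<notin> Y" "w \<notin> closed_nbhd G v"
      by blast
    then show ?thesis
    proof cases
      case 1
      then show ?thesis
        unfolding has_unique_color_iff by (intro bexI[OF _ self] ballI impI) (rule own)
    next
      case 2
      moreover have "w \<in> Y"
        using near by (simp add: neighborhoods_near_def)
      ultimately show ?thesis
        unfolding has_unique_color_iff by (intro bexI[of _ w] ballI impI) (rule own)
    next
      case 3
      then have "closed_nbhd G v \<subseteq> insert v Y"
        using near v by (auto simp: neighborhoods_near_def)
      then have "z = v" if "z \<in> closed_nbhd G v" "C z = C v" for z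
        using that 3(1) own[of z v] by auto
      then show ?thesis
        unfolding has_unique_color_iff by (intro bexI[OF _ self] ballI impI)
    qed
  qed
  moreover have "C v \<in> {1..card Y + 1}" for v
    using eY[of v] by (auto simp: C_def)
  ultimately show ?thesis
    unfolding cf_cn_coloring_def by blast
qed

definition free_verts :: "nat pair_pre_digraph \<Rightarrow> nat set \<Rightarrow> nat set" where
  "free_verts G Y = {v \<in> pverts G. rank G Y v \<le> card Y}"

text \<open>Outside \<open>Y\<close> a vertex is determined by its set of neighbors in
  \<open>Y\<close> and its rank, and a free vertex has one of the ranks
  \<open>0, ..., card Y\<close>.\<close>

lemma card_free_verts:
  assumes "finite (pverts G)" and "finite Y"
  shows "card (free_verts G Y) \<le> card Y + 2 ^ card Y * (card Y + 1)"
proof -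
  let ?F = "free_verts G Y - Y"
  have "card ?F \<le> card (Pow Y \<times> {..card Y})"
  proof (rule card_inj_on_le)
    show "inj_on (\<lambda>v. (closed_nbhd G v \<inter> Y, rank G Y v)) ?F"
      by (rule inj_onI, rule rank_inj) (auto simp: twins_def free_verts_def)
    show "(\<lambda>v. (closed_nbhd G v \<inter> Y, rank G Y v)) ` ?F \<subseteq> Pow Y \<times> {..card Y}"
      by (auto simp: free_verts_def)
  qed (use assms in simp)
  also have "\<dots> = 2 ^ card Y * (card Y + 1)"
    using assms by (simp add: card_cartesian_product card_Pow)
  finally have "card (Y \<union> ?F) \<le> card Y + 2 ^ card Y * (card Y + 1)"
    using card_Un_le[of Y ?F] by simp
  moreover have "card (free_verts G Y) \<le> card (Y \<union> ?F)"
    using assms by (intro card_mono) (auto simp: free_verts_def)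
  ultimately show ?thesis
    by simp
qed

section \<open>Numbering the reduced colorings\<close>

text \<open>The base \<open>K\<close> digits of \<open>N\<close> are the colors, less one, of the free vertices.\<close>

definition decodes :: "nat pair_pre_digraph \<Rightarrow> nat set \<Rightarrow> nat \<Rightarrow> nat \<Rightarrow> nat \<Rightarrow> (nat \<Rightarrow> nat) \<Rightarrow> bool" where
  "decodes G Y K N j C \<longleftrightarrow> (\<forall>v<j. C v =
     (if rank G Y v \<le> card Y then N div K ^ card (free_verts G Y \<inter> {..<v}) mod K + 1
      else C (prev_twin G Y v)))"

text \<open>The digit of \<open>v\<close> stands at the position given by the number of smaller
  elements of \<open>F\<close>. A new largest element contributes the leading digit.\<close>

lemma ex_code:
  fixes F :: "nat set" and K :: nat
  assumes "0 < K" and "\<And>v. v \<in> F \<Longrightarrow> c v < K" and fin: "finite F"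
  shows "\<exists>N < K ^ card (F \<inter> {..<j}). \<forall>v \<in> F \<inter> {..<j}. N div K ^ card (F \<inter> {..<v}) mod K = c v"
proof (induct j)
  case 0
  then show ?case
    by simp
next
  case (Suc j)
  then obtain N where N: "N < K ^ card (F \<inter> {..<j})"
      "\<And>v. v \<in> F \<Longrightarrow> v < j \<Longrightarrow> N div K ^ card (F \<inter> {..<v}) mod K = c v"
    by auto
  show ?case
  proof (cases "j \<in> F")
    case False
    then have "F \<inter> {..<Suc j} = F \<inter> {..<j}"
      by (auto simp: less_Suc_eq)
    then show ?thesis
      using N by auto
  next
    case True
    define m where "m = card (F \<inter> {..<j})"
    have "F \<inter> {..<Suc j} = insert j (F \<inter> {..<j})"
      using True by auto
    then have m: "card (F \<inter> {..<Suc j}) = Suc m"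
      using fin by (simp add: m_def)
    let ?N = "N + c j * K ^ m"
    have "?N < K ^ m + c j * K ^ m"
      using N(1) by (simp add: m_def)
    also have "\<dots> = Suc (c j) * K ^ m"
      by simp
    also have "\<dots> \<le> K * K ^ m"
      using assms(2)[OF True] by (intro mult_right_mono) auto
    finally have "?N < K ^ Suc m"
      by simp
    moreover have "?N div K ^ card (F \<inter> {..<v}) mod K = c v" if v: "v \<in> F" "v < Suc j" for v
    proof (cases "v = j")
      case True
      then show ?thesis
        using N(1) assms(1) assms(2)[OF v(1)] by (simp flip: m_def)
    next
      case False
      then have vj: "v < j"
        using v by simp
      have "F \<inter> {..<v} \<subset> F \<inter> {..<j}"
        using v(1) vj by auto
      then have "card (F \<inter> {..<v}) < m"
        unfolding m_def using fin by (intro psubset_card_mono) auto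
      \<comment> \<open>The position of \<open>v\<close> is below \<open>m\<close>, so after the
        division the new leading term is still a multiple of \<open>K\<close> and vanishes modulo
        \<open>K\<close>.\<close>
      then obtain i where i: "m = card (F \<inter> {..<v}) + Suc i"
        by (metis add_Suc_right less_imp_Suc_add)
      have *: "?N = N + (c j * K ^ i * K) * K ^ card (F \<inter> {..<v})"
        unfolding i by (simp add: power_add mult_ac)
      have "?N div K ^ card (F \<inter> {..<v}) = c j * K ^ i * K + N div K ^ card (F \<inter> {..<v})"
        unfolding * by (rule div_mult_self1) (use assms(1) in simp)
      then show ?thesis
        using N(2)[OF v(1) vj] by simp
    qed
    ultimately show ?thesis
      unfolding m by (intro exI[of _ ?N]) auto
  qed
qed

text \<open>By strong induction on \<open>v\<close>, the digits fix the free vertices and the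
  copying rule fixes the others. The claim covers all \<open>C'\<close> because the array that the
  program fills is specified only below \<open>n\<close>.\<close>

lemma decode_reduced:
  assumes V: "pverts G = {..<n}" and red: "reduced G Y C" and K: "0 < K" "C ` {..<n} \<subseteq> {1..K}"
  shows "\<exists>N < K ^ card (free_verts G Y). \<forall>C'. decodes G Y K N n C' \<longrightarrow> (\<forall>v<n. C' v = C v)"
proof -
  let ?F = "free_verts G Y"
  have F: "?F = {v. v < n \<and> rank G Y v \<le> card Y}"
    unfolding free_verts_def V by auto
  have "C v - 1 < K" "C v - 1 + 1 = C v" if "v < n" for v
  proof -
    have "C v \<in> {1..K}"
      using that K(2) by blast
    then show "C v - 1 < K" "C v - 1 + 1 = C v"
      by auto
  qed
  note C = this
  have "finite ?F" "?F \<inter> {..<n} = ?F"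
    unfolding F by auto
  then obtain N where N: "N < K ^ card ?F"
      "\<And>v. v \<in> ?F \<Longrightarrow> N div K ^ card (?F \<inter> {..<v}) mod K = C v - 1"
    using ex_code[OF K(1), of ?F "\<lambda>v. C v - 1" n] C(1) F by auto
  have "C' v = C v" if "decodes G Y K N n C'" "v < n" for C' v
    using that(2)
  proof (induction v rule: less_induct)
    case (less v)
    show ?case
    proof (cases "rank G Y v \<le> card Y")
      case True
      then show ?thesis
        using that(1) less.prems N(2)[of v] C(2)[OF less.prems] by (simp add: decodes_def F)
    next
      case False
      then have "prev_twin G Y v < v"
        using prev_twin_in[of G Y v] by (simp add: earlier_twins_def)
      moreover have "C v = C (prev_twin G Y v)"
        using red False less.prems V by (simp add: reduced_def)
      ultimately show ?thesis
        using that(1) less False by (simp add: decodes_def)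
    qed
  qed
  then show ?thesis
    using N(1) by blast
qed

section \<open>Total correctness with time bounds\<close>

text \<open>An upper bound on the steps instead of their exact number lets branches of different
  cost share one bound. With the start state as a parameter, \<open>Q\<close> can refer to it
  directly.\<close>

definition runs :: "com \<Rightarrow> mem \<Rightarrow> nat \<Rightarrow> (mem \<Rightarrow> bool) \<Rightarrow> bool" where
  "runs p s T Q \<longleftrightarrow> (\<exists>t s'. exec p s t s' \<and> t \<le> T \<and> Q s')"

primrec assigned :: "com \<Rightarrow> string set" where
  "assigned Skip = {}"
| "assigned (Assign a e e') = {a}"
| "assigned (Seq p q) = assigned p \<union> assigned q"
| "assigned (Cond e p q) = assigned p \<union> assigned q"
| "assigned (While e p) = assigned p"

definition agree_off :: "string set \<Rightarrow> mem \<Rightarrow> mem \<Rightarrow> bool" where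
  "agree_off M s s' \<longleftrightarrow> (\<forall>a. a \<notin> M \<longrightarrow> s' a = s a)"

lemma agree_offD: "agree_off M s s' \<Longrightarrow> a \<notin> M \<Longrightarrow> s' a = s a"
  by (simp add: agree_off_def)

text \<open>The frame rule. \<open>runs_conseq\<close> passes it on together with each
  postcondition, so that postconditions need not repeat what a program leaves alone.\<close>

lemma exec_agree_off: "exec p s t s' \<Longrightarrow> agree_off (assigned p) s s'"
  by (induction rule: exec.induct) (auto simp: agree_off_def)

lemma runs_conseq:
  assumes "runs p s T P" and "\<And>s'. P s' \<Longrightarrow> agree_off (assigned p) s s' \<Longrightarrow> Q s'" and "T \<le> T'"
  shows "runs p s T' Q"
proof -
  obtain t s' where "exec p s t s'" "t \<le> T" "P s'"
    using assms(1) unfolding runs_def by blast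
  moreover from this have "Q s'"
    using assms(2) exec_agree_off by blast
  ultimately show ?thesis
    unfolding runs_def using assms(3) le_trans by blast
qed

lemma runs_Skip: "Q s \<Longrightarrow> 1 \<le> T \<Longrightarrow> runs Skip s T Q"
  unfolding runs_def using exec.Skip by blast

lemma runs_Assign:
  "Q (s(a := (s a)(val e s := val e' s))) \<Longrightarrow> 1 \<le> T \<Longrightarrow> runs (Assign a e e') s T Q"
  unfolding runs_def using exec.Assign by blast

lemma runs_Seq:
  "runs p s T (\<lambda>s'. runs q s' T' Q) \<Longrightarrow> T + T' \<le> U \<Longrightarrow> runs (Seq p q) s U Q"
  unfolding runs_def by (meson add_mono exec.Seq le_trans)

lemma runs_Seq_conseq:
  assumes "runs p s T P" and "\<And>s'. P s' \<Longrightarrow> agree_off (assigned p) s s' \<Longrightarrow> runs q s' T' Q"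
    and "T + T' \<le> U"
  shows "runs (Seq p q) s U Q"
  using runs_conseq[OF assms(1,2) order_refl] assms(3) by (rule runs_Seq)

lemma runs_Assign_Seq:
  "runs q (s(a := (s a)(val e s := val e' s))) T Q \<Longrightarrow> Suc T \<le> U \<Longrightarrow> runs (Seq (Assign a e e') q) s U Q"
  by (rule runs_Seq[where T = 1 and T' = T], rule runs_Assign) simp_all

lemma runs_Cond:
  assumes "val e s \<noteq> 0 \<Longrightarrow> runs p s T Q" and "val e s = 0 \<Longrightarrow> runs q s T Q" and "Suc T \<le> U"
  shows "runs (Cond e p q) s U Q"
proof (cases "val e s = 0")
  case True
  then show ?thesis
    using assms(2,3) unfolding runs_def by (meson CondFalse Suc_le_mono le_trans)
next
  case False
  then show ?thesis
    using assms(1,3) unfolding runs_def by (meson CondTrue Suc_le_mono le_trans)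
qed

text \<open>The measure bounds the number of remaining rounds. Each costs the body and one test, and
  the failing test costs one more step.\<close>

lemma runs_While:
  assumes "I s"
    and body: "\<And>s. I s \<Longrightarrow> val e s \<noteq> 0 \<Longrightarrow> runs p s B (\<lambda>s'. I s' \<and> \<mu> s' < \<mu> s)"
    and "1 + \<mu> s * (B + 1) \<le> U"
  shows "runs (While e p) s U (\<lambda>s'. I s' \<and> val e s' = 0)"
proof -
  have "\<exists>t s'. exec (While e p) s t s' \<and> t \<le> 1 + \<mu> s * (B + 1) \<and> I s' \<and> val e s' = 0"
    using \<open>I s\<close>
  proof (induction "\<mu> s" arbitrary: s rule: less_induct)
    case less
    show ?case
    proof (cases "val e s = 0")
      case True
      then show ?thesis
        using less.prems WhileFalse[OF True] by fastforce
    next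
      case False
      then obtain t s' where 1: "exec p s t s'" "t \<le> B" "I s'" "\<mu> s' < \<mu> s"
        using body[OF less.prems] unfolding runs_def by blast
      from less.hyps[OF 1(4,3)] obtain t' s''
        where 2: "exec (While e p) s' t' s''" "t' \<le> 1 + \<mu> s' * (B + 1)" "I s''" "val e s'' = 0"
        by blast
      have "Suc (t + t') \<le> 1 + (Suc (\<mu> s')) * (B + 1)"
        using 1(2) 2(2) by simp
      also have "\<dots> \<le> 1 + \<mu> s * (B + 1)"
        using 1(4) by (intro add_left_mono mult_right_mono) auto
      finally show ?thesis
        using WhileTrue[OF False 1(1) 2(1)] 2(3,4) by blast
    qed
  qed
  then show ?thesis
    unfolding runs_def using assms(3) le_trans by blast
qed

abbreviation var :: "string \<Rightarrow> exp" where
  "var x \<equiv> Cell x (Const 0)"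

definition For :: "string \<Rightarrow> exp \<Rightarrow> com \<Rightarrow> com" where
  "For i e p = Seq (Assign i (Const 0) (Const 0))
     (While (Sub e (var i)) (Seq p (Assign i (Const 0) (Add (var i) (Const 1)))))"

lemma assigned_For [simp]: "assigned (For i e p) = insert i (assigned p)"
  by (simp add: For_def insert_commute)

text \<open>The bound \<open>e\<close> is evaluated anew in every round, hence \<open>bound\<close>
  asks for the value \<open>m\<close> in all states that differ from \<open>s\<close> only where the
  loop writes. By \<open>index\<close> the invariant survives changes of the counter. A round costs
  \<open>B\<close> plus test and increment; the remaining 2 are for the initialization and the
  failing test.\<close>

lemma runs_For:
  assumes init: "I 0 s"
    and step: "\<And>j s'. j < m \<Longrightarrow> s' i 0 = j \<Longrightarrow> agree_off (insert i (assigned p)) s s' \<Longrightarrow> I j s' \<Longrightarrow>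
      runs p s' B (I (Suc j))"
    and index: "\<And>j s' x. I j s' \<Longrightarrow> I j (s'(i := (s' i)(0 := x)))"
    and bound: "\<And>s'. agree_off (insert i (assigned p)) s s' \<Longrightarrow> val e s' = m"
    and i: "i \<notin> assigned p"
    and T: "2 + m * (B + 2) \<le> T"
  shows "runs (For i e p) s T (I m)"
proof -
  define J where "J s' \<longleftrightarrow> agree_off (insert i (assigned p)) s s' \<and> s' i 0 \<le> m \<and> I (s' i 0) s'" for s'
  let ?s = "s(i := (s i)(0 := 0))"
  let ?body = "Seq p (Assign i (Const 0) (Add (var i) (Const 1)))"
  have "runs (While (Sub e (var i)) ?body) ?s (1 + m * (B + 1 + 1))
    (\<lambda>s'. J s' \<and> val (Sub e (var i)) s' = 0)"
  proof (rule runs_While[where \<mu> = "\<lambda>s'. m - s' i 0"])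
    show "J ?s"
      using index[OF init] by (auto simp: J_def agree_off_def)
  next
    fix s'
    assume J: "J s'" and "val (Sub e (var i)) s' \<noteq> 0"
    then have lt: "s' i 0 < m"
      using bound by (auto simp: J_def)
    show "runs ?body s' (B + 1) (\<lambda>s''. J s'' \<and> m - s'' i 0 < m - s' i 0)"
    proof (rule runs_Seq)
      show "runs p s' B (\<lambda>s''. runs (Assign i (Const 0) (Add (var i) (Const 1))) s'' 1
        (\<lambda>s''. J s'' \<and> m - s'' i 0 < m - s' i 0))"
      proof (rule runs_conseq[OF step[of "s' i 0" s', OF lt refl]])
        fix s''
        assume I: "I (Suc (s' i 0)) s''" and fr: "agree_off (assigned p) s' s''"
        have "s'' i = s' i"
          using agree_offD[OF fr i] .
        moreover have "agree_off (insert i (assigned p)) s s''"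
          using J fr by (auto simp: J_def agree_off_def)
        ultimately show "runs (Assign i (Const 0) (Add (var i) (Const 1))) s'' 1
            (\<lambda>s''. J s'' \<and> m - s'' i 0 < m - s' i 0)"
          using lt index[OF I] by (intro runs_Assign) (auto simp: J_def agree_off_def)
      qed (use J in \<open>auto simp: J_def\<close>)
    qed simp
  qed simp
  then have "runs (While (Sub e (var i)) ?body) ?s (1 + m * (B + 1 + 1)) (I m)"
  proof (rule runs_conseq)
    fix s'
    assume "J s' \<and> val (Sub e (var i)) s' = 0"
    then show "I m s'"
      using bound[of s'] by (auto simp: J_def)
  qed simp
  then show ?thesis
    unfolding For_def using T
    by (intro runs_Seq[where T = 1] runs_Assign) auto
qed

section \<open>Boolean tests as arithmetic expressions\<close>

definition tneg :: "exp \<Rightarrow> exp" where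
  "tneg e = Sub (Const 1) e"

definition tor :: "exp \<Rightarrow> exp \<Rightarrow> exp" where
  "tor e e' = Add e e'"

text \<open>De Morgan, as there is no multiplication.\<close>

definition tand :: "exp \<Rightarrow> exp \<Rightarrow> exp" where
  "tand e e' = tneg (tor (tneg e) (tneg e'))"

text \<open>The two truncated differences add up to the distance of the values.\<close>

definition teq :: "exp \<Rightarrow> exp \<Rightarrow> exp" where
  "teq e e' = tneg (Add (Sub e e') (Sub e' e))"

definition holds :: "exp \<Rightarrow> mem \<Rightarrow> bool" where
  "holds e s \<longleftrightarrow> val e s \<noteq> 0"

lemma holds_simps [simp]:
  "holds (tneg e) s \<longleftrightarrow> \<not> holds e s"
  "holds (tor e e') s \<longleftrightarrow> holds e s \<or> holds e' s"
  "holds (tand e e') s \<longleftrightarrow> holds e s \<and> holds e' s"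
  "holds (teq e e') s \<longleftrightarrow> val e s = val e' s"
  "holds (Sub e e') s \<longleftrightarrow> val e' s < val e s"
  "holds (Cell a e) s \<longleftrightarrow> s a (val e s) \<noteq> 0"
  by (auto simp: holds_def tneg_def tor_def tand_def teq_def)

primrec arrays :: "exp \<Rightarrow> string set" where
  "arrays (Const n) = {}"
| "arrays (Cell a e) = insert a (arrays e)"
| "arrays (Add e e') = arrays e \<union> arrays e'"
| "arrays (Sub e e') = arrays e \<union> arrays e'"

lemma arrays_simps [simp]:
  "arrays (tneg e) = arrays e"
  "arrays (tor e e') = arrays e \<union> arrays e'"
  "arrays (tand e e') = arrays e \<union> arrays e'"
  "arrays (teq e e') = arrays e \<union> arrays e'"
  by (auto simp: tneg_def tor_def tand_def teq_def)

section \<open>Deciding quantified tests\<close>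

text \<open>Formulas are prenex, with all connectives inside the atom. Conditions free of the
  innermost variables thus end up under their quantifiers, which is harmless because the ranges are
  nonempty wherever this is done.\<close>

datatype test = Atom exp | Forall string test | Exists string test

text \<open>Quantifiers range over the numbers below the content of \<open>n\<close>.\<close>

primrec sat :: "test \<Rightarrow> mem \<Rightarrow> bool" where
  "sat (Atom e) s = holds e s"
| "sat (Forall i \<phi>) s = (\<forall>x < s ''n'' 0. sat \<phi> (s(i := (s i)(0 := x))))"
| "sat (Exists i \<phi>) s = (\<exists>x < s ''n'' 0. sat \<phi> (s(i := (s i)(0 := x))))"

primrec bound_vars :: "test \<Rightarrow> string set" where
  "bound_vars (Atom e) = {}"
| "bound_vars (Forall i \<phi>) = insert i (bound_vars \<phi>)"
| "bound_vars (Exists i \<phi>) = insert i (bound_vars \<phi>)"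

text \<open>\<open>decide\<close> keeps truth values in \<open>r\<close>, takes the loop bound from
  \<open>n\<close> and uses the bound variables as loop counters. A repeated variable would let an
  inner loop overwrite the counter of an outer one.\<close>

primrec wf_test :: "test \<Rightarrow> bool" where
  "wf_test (Atom e) \<longleftrightarrow> ''r'' \<notin> arrays e"
| "wf_test (Forall i \<phi>) \<longleftrightarrow> wf_test \<phi> \<and> i \<notin> insert ''n'' (insert ''r'' (bound_vars \<phi>))"
| "wf_test (Exists i \<phi>) \<longleftrightarrow> wf_test \<phi> \<and> i \<notin> insert ''n'' (insert ''r'' (bound_vars \<phi>))"

text \<open>The truth value of the subformula at quantifier depth \<open>k\<close> is kept in cell \<open>k\<close> of \<open>r\<close>.\<close>

primrec decide :: "test \<Rightarrow> nat \<Rightarrow> com" where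
  "decide (Atom e) k = Assign ''r'' (Const k) e"
| "decide (Forall i \<phi>) k = Seq (Assign ''r'' (Const k) (Const 1)) (For i (var ''n'')
     (Seq (decide \<phi> (Suc k)) (Cond (Cell ''r'' (Const (Suc k))) Skip (Assign ''r'' (Const k) (Const 0)))))"
| "decide (Exists i \<phi>) k = Seq (Assign ''r'' (Const k) (Const 0)) (For i (var ''n'')
     (Seq (decide \<phi> (Suc k)) (Cond (Cell ''r'' (Const (Suc k))) (Assign ''r'' (Const k) (Const 1)) Skip)))"

lemma assigned_decide [simp]: "assigned (decide \<phi> k) = insert ''r'' (bound_vars \<phi>)"
  by (induction \<phi> arbitrary: k) auto

primrec decide_time :: "test \<Rightarrow> nat \<Rightarrow> nat" where
  "decide_time (Atom e) n = 1"
| "decide_time (Forall i \<phi>) n = 3 + n * (decide_time \<phi> n + 4)"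
| "decide_time (Exists i \<phi>) n = 3 + n * (decide_time \<phi> n + 4)"

text \<open>The change that \<open>decide\<close> may cause: all of \<open>r\<close>, but only cell
  0 of the loop counters. This is finer than \<open>agree_off\<close>, which gives up whole
  arrays.\<close>

definition similar :: "string set \<Rightarrow> mem \<Rightarrow> mem \<Rightarrow> bool" where
  "similar B s s' \<longleftrightarrow> (\<forall>a k. a \<noteq> ''r'' \<longrightarrow> (a \<in> B \<longrightarrow> k \<noteq> 0) \<longrightarrow> s' a k = s a k)"

lemma val_similar: "similar {} s s' \<Longrightarrow> ''r'' \<notin> arrays e \<Longrightarrow> val e s' = val e s"
  by (induction e) (auto simp: similar_def)

lemma similar_upd: "similar (insert i B) s s' \<Longrightarrow> similar B (s(i := (s i)(0 := x))) (s'(i := (s' i)(0 := x)))"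
  by (auto simp: similar_def)

lemma n_notin_bound_vars: "wf_test \<phi> \<Longrightarrow> ''n'' \<notin> bound_vars \<phi>"
  by (induction \<phi>) auto

lemma r_notin_bound_vars: "wf_test \<phi> \<Longrightarrow> ''r'' \<notin> bound_vars \<phi>"
  by (induction \<phi>) auto

text \<open>A quantifier overwrites its variable before the body is read, so leftover counter values
  from earlier rounds cannot affect the truth value.\<close>

lemma sat_similar: "similar (bound_vars \<phi>) s s' \<Longrightarrow> wf_test \<phi> \<Longrightarrow> sat \<phi> s' = sat \<phi> s"
proof (induction \<phi> arbitrary: s s')
  case (Atom e)
  then show ?case
    using val_similar by (simp add: holds_def)
next
  case (Forall i \<phi>)
  have "s' ''n'' 0 = s ''n'' 0"
    using Forall.prems n_notin_bound_vars[of \<phi>] by (auto simp: similar_def)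
  moreover have "sat \<phi> (s'(i := (s' i)(0 := x))) = sat \<phi> (s(i := (s i)(0 := x)))" for x
    using Forall.prems by (intro Forall.IH similar_upd) auto
  ultimately show ?case
    by simp
next
  case (Exists i \<phi>)
  have "s' ''n'' 0 = s ''n'' 0"
    using Exists.prems n_notin_bound_vars[of \<phi>] by (auto simp: similar_def)
  moreover have "sat \<phi> (s'(i := (s' i)(0 := x))) = sat \<phi> (s(i := (s i)(0 := x)))" for x
    using Exists.prems by (intro Exists.IH similar_upd) auto
  ultimately show ?case
    by simp
qed

definition decided :: "test \<Rightarrow> nat \<Rightarrow> mem \<Rightarrow> mem \<Rightarrow> bool" where
  "decided \<phi> k s s' \<longleftrightarrow> (s' ''r'' k \<noteq> 0 \<longleftrightarrow> sat \<phi> s) \<and> similar (bound_vars \<phi>) s s' \<and>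
     (\<forall>j<k. s' ''r'' j = s ''r'' j)"

text \<open>Treats both quantifiers at once: \<open>f\<close> is the update of the accumulator in
  cell \<open>k\<close> for a given truth value of the body, and \<open>R j\<close> is what the
  accumulator satisfies after \<open>j\<close> rounds.\<close>

lemma decide_quantifier:
  assumes IH: "\<And>s. s ''n'' 0 = n \<Longrightarrow> runs (decide \<phi> (Suc k)) s (decide_time \<phi> n) (decided \<phi> (Suc k) s)"
    and wf: "wf_test \<phi>" "i \<notin> insert ''n'' (insert ''r'' (bound_vars \<phi>))"
    and n: "s ''n'' 0 = n"
    and p: "\<And>s Q. val (Cell ''r'' (Const (Suc k))) s \<noteq> 0 \<Longrightarrow> Q (s(''r'' := (s ''r'')(k := f True (s ''r'' k)))) \<Longrightarrow> runs p s 1 Q"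
    and q: "\<And>s Q. val (Cell ''r'' (Const (Suc k))) s = 0 \<Longrightarrow> Q (s(''r'' := (s ''r'')(k := f False (s ''r'' k)))) \<Longrightarrow> runs q s 1 Q"
    and asg: "assigned p \<subseteq> {''r''}" "assigned q \<subseteq> {''r''}"
    and R0: "R 0 b"
    and R: "\<And>j x. j < n \<Longrightarrow> R j x \<Longrightarrow> R (Suc j) (f (sat \<phi> (s(i := (s i)(0 := j)))) x)"
  shows "runs (Seq (Assign ''r'' (Const k) (Const b)) (For i (var ''n'')
     (Seq (decide \<phi> (Suc k)) (Cond (Cell ''r'' (Const (Suc k))) p q)))) s (3 + n * (decide_time \<phi> n + 4))
     (\<lambda>s'. R n (s' ''r'' k) \<and> similar (insert i (bound_vars \<phi>)) s s' \<and> (\<forall>j<k. s' ''r'' j = s ''r'' j))"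
proof -
  let ?B = "insert i (bound_vars \<phi>)"
  let ?I = "\<lambda>j s'. R j (s' ''r'' k) \<and> similar ?B s s' \<and> (\<forall>j<k. s' ''r'' j = s ''r'' j)"
  let ?p = "Seq (decide \<phi> (Suc k)) (Cond (Cell ''r'' (Const (Suc k))) p q)"
  have r: "''r'' \<notin> bound_vars \<phi>"
    by (rule r_notin_bound_vars[OF wf(1)])
  have n': "''n'' \<notin> bound_vars \<phi>"
    by (rule n_notin_bound_vars[OF wf(1)])
  have asg': "assigned ?p = insert ''r'' (bound_vars \<phi>)"
    using asg by auto
  show ?thesis
  proof (rule runs_Seq[where T = 1 and T' = "2 + n * (decide_time \<phi> n + 2 + 2)"], rule runs_Assign)
    let ?s = "s(''r'' := (s ''r'')(val (Const k) s := val (Const b) s))"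
    show "runs (For i (var ''n'') ?p) ?s (2 + n * (decide_time \<phi> n + 2 + 2)) (?I n)"
    proof (rule runs_For[where I = ?I and B = "decide_time \<phi> n + 2"])
      show "?I 0 ?s"
        using R0 by (auto simp: similar_def)
    next
      fix j s'
      assume j: "j < n" and i: "s' i 0 = j" and I: "?I j s'"
        and fr: "agree_off (insert i (assigned ?p)) ?s s'"
      have nn: "s' ''n'' 0 = n"
        using I n wf(2) n' by (auto simp: similar_def)
      have sim: "similar (bound_vars \<phi>) (s(i := (s i)(0 := j))) s'"
        using I i by (auto simp: similar_def)
      have sat: "sat \<phi> s' = sat \<phi> (s(i := (s i)(0 := j)))"
        by (rule sat_similar[OF sim wf(1)])
      show "runs ?p s' (decide_time \<phi> n + 2) (?I (Suc j))"
      proof (rule runs_Seq[where T' = 2])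
        show "runs (decide \<phi> (Suc k)) s' (decide_time \<phi> n)
          (\<lambda>s''. runs (Cond (Cell ''r'' (Const (Suc k))) p q) s'' 2 (?I (Suc j)))"
        proof (rule runs_conseq[OF IH[of s', OF nn]])
          fix s''
          assume D: "decided \<phi> (Suc k) s' s''"
          have I': "R j (s'' ''r'' k)" "similar ?B s s''" "\<forall>j<k. s'' ''r'' j = s ''r'' j"
            using D I by (auto simp: decided_def similar_def)
          have upd: "similar ?B s (s''(''r'' := g))" for g
            using I'(2) by (auto simp: similar_def)
          have t: "val (Cell ''r'' (Const (Suc k))) s'' \<noteq> 0 \<longleftrightarrow> sat \<phi> (s(i := (s i)(0 := j)))"
            using D sat by (simp add: decided_def)
          show "runs (Cond (Cell ''r'' (Const (Suc k))) p q) s'' 2 (?I (Suc j))"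
          proof (rule runs_Cond[where T = 1])
            assume a: "val (Cell ''r'' (Const (Suc k))) s'' \<noteq> 0"
            with t have "sat \<phi> (s(i := (s i)(0 := j)))" by simp
            with R[OF j I'(1)] show "runs p s'' 1 (?I (Suc j))"
              using I'(3) upd by (intro p[OF a]) simp
          next
            assume a: "val (Cell ''r'' (Const (Suc k))) s'' = 0"
            with t have "\<not> sat \<phi> (s(i := (s i)(0 := j)))" by simp
            with R[OF j I'(1)] show "runs q s'' 1 (?I (Suc j))"
              using I'(3) upd by (intro q[OF a]) simp
          qed simp
        qed simp
      qed simp
    next
      fix j s' x
      assume "?I j s'"
      then show "?I j (s'(i := (s' i)(0 := x)))"
        using wf(2) by (auto simp: similar_def)
    next
      fix s'
      assume "agree_off (insert i (assigned ?p)) ?s s'"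
      then show "val (var ''n'') s' = n"
        unfolding asg' using n wf(2) n' by (auto simp: agree_off_def)
    next
      show "i \<notin> assigned ?p"
        unfolding asg' using wf(2) by auto
    qed simp
  qed (auto simp: add_mult_distrib2)
qed

lemma runs_decide:
  "wf_test \<phi> \<Longrightarrow> s ''n'' 0 = n \<Longrightarrow> runs (decide \<phi> k) s (decide_time \<phi> n) (decided \<phi> k s)"
proof (induction \<phi> arbitrary: k s)
  case (Atom e)
  then show ?case
    by (auto intro!: runs_Assign simp: decided_def similar_def holds_def)
next
  case (Forall i \<phi>)
  show ?case
    unfolding decide.simps decide_time.simps
  proof (rule runs_conseq[OF decide_quantifier[where f = "\<lambda>t x. if t then x else 0"
      and R = "\<lambda>j x. x \<noteq> 0 \<longleftrightarrow> (\<forall>y<j. sat \<phi> (s(i := (s i)(0 := y))))"]])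
    show "runs (decide \<phi> (Suc k)) s (decide_time \<phi> n) (decided \<phi> (Suc k) s)" if "s ''n'' 0 = n" for s
      using Forall.IH that Forall.prems(1) by simp
  qed (use Forall.prems in \<open>auto intro!: runs_Skip runs_Assign simp: decided_def less_Suc_eq split: if_splits\<close>)
next
  case (Exists i \<phi>)
  show ?case
    unfolding decide.simps decide_time.simps
  proof (rule runs_conseq[OF decide_quantifier[where f = "\<lambda>t x. if t then 1 else x"
      and R = "\<lambda>j x. x \<noteq> 0 \<longleftrightarrow> (\<exists>y<j. sat \<phi> (s(i := (s i)(0 := y))))"]])
    show "runs (decide \<phi> (Suc k)) s (decide_time \<phi> n) (decided \<phi> (Suc k) s)" if "s ''n'' 0 = n" for s
      using Exists.IH that Exists.prems(1) by simp
  qed (use Exists.prems in \<open>auto intro!: runs_Skip runs_Assign simp: decided_def less_Suc_eq split: if_splits\<close>)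
qed

section \<open>The program\<close>

text \<open>The machine cannot multiply, so the row offsets of the adjacency matrix are tabulated
  beforehand by repeated addition.\<close>

definition adjacent :: "exp \<Rightarrow> exp \<Rightarrow> exp" where
  "adjacent e e' = Cell ''adj'' (Add (Cell ''row'' e) e')"

lemma val_adjacent [simp]: "val (adjacent e e') s = s ''adj'' (s ''row'' (val e s) + val e' s)"
  by (simp add: adjacent_def)

lemma holds_adjacent [simp]: "holds (adjacent e e') s \<longleftrightarrow> s ''adj'' (s ''row'' (val e s) + val e' s) \<noteq> 0"
  by (simp add: holds_def)

lemma arrays_adjacent [simp]: "arrays (adjacent e e') = {''adj'', ''row''} \<union> arrays e \<union> arrays e'"
  by (auto simp: adjacent_def)

definition row_com :: com where
  "row_com = For ''v'' (var ''n'')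
     (Assign ''row'' (Add (var ''v'') (Const 1)) (Add (Cell ''row'' (var ''v'')) (var ''n'')))"

definition dominates_test :: test where
  "dominates_test = Forall ''u'' (Forall ''z'' (Atom (tand (tneg (Cell ''X'' (var ''v'')))
     (tor (Cell ''X'' (var ''u'')) (tor (Cell ''X'' (var ''z'')) (tor (teq (var ''u'') (var ''v''))
       (tor (tneg (adjacent (var ''u'') (var ''z''))) (adjacent (var ''v'') (var ''u'')))))))))"

definition find_com :: com where
  "find_com = For ''v'' (var ''n'') (Seq (decide dominates_test 0)
     (Cond (var ''r'') (Assign ''w'' (Const 0) (var ''v'')) Skip))"

definition count_com :: com where
  "count_com = For ''v'' (var ''n'') (Cond (Cell ''X'' (var ''v''))
     (Assign ''dd'' (Const 0) (Add (var ''dd'') (Const 1))) Skip)"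

definition twins_test :: test where
  "twins_test = Forall ''x'' (Atom (tand (tneg (Cell ''X'' (var ''u''))) (tand (tneg (Cell ''X'' (var ''v'')))
     (tor (tneg (Cell ''X'' (var ''x'')))
       (teq (adjacent (var ''u'') (var ''x'')) (adjacent (var ''v'') (var ''x'')))))))"

text \<open>As \<open>u\<close> ascends, the entries for a greater twin overwrite those for a
  smaller one, so that the previous twin prevails. The entry \<open>cnt\<close> of \<open>u\<close>
  is already final because \<open>u\<close> is smaller than \<open>v\<close>.\<close>

definition twins_com :: com where
  "twins_com = For ''v'' (var ''n'') (Seq (Assign ''cnt'' (var ''v'') (Const 0))
     (For ''u'' (var ''v'') (Seq (decide twins_test 0) (Cond (var ''r'')
       (Seq (Assign ''par'' (var ''v'') (var ''u''))
         (Assign ''cnt'' (var ''v'') (Add (Cell ''cnt'' (var ''u'')) (Const 1)))) Skip))))"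

text \<open>Repeated subtraction may take as many rounds as the dividend, which is affordable
  because all codes are bounded in terms of \<open>card X\<close>.\<close>

definition div_com :: com where
  "div_com = Seq (Assign ''q'' (Const 0) (Const 0)) (While (tneg (Sub (var ''k'') (var ''R'')))
     (Seq (Assign ''R'' (Const 0) (Sub (var ''R'') (var ''k''))) (Assign ''q'' (Const 0) (Add (var ''q'') (Const 1)))))"

text \<open>Digits are consumed from the lowest on while \<open>R\<close> keeps the rest. What is
  left in \<open>R\<close> tells whether the code has more digits than there are free vertices, so
  the number of codes never has to be computed.\<close>

definition decode_com :: com where
  "decode_com = Seq (Assign ''R'' (Const 0) (var ''N'')) (For ''v'' (var ''n'')
     (Cond (tneg (Sub (Cell ''cnt'' (var ''v'')) (var ''dd'')))
       (Seq div_com (Seq (Assign ''col'' (var ''v'') (Add (var ''R'') (Const 1))) (Assign ''R'' (Const 0) (var ''q''))))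
       (Assign ''col'' (var ''v'') (Cell ''col'' (Cell ''par'' (var ''v''))))))"

definition nbhd_test :: "string \<Rightarrow> string \<Rightarrow> exp" where
  "nbhd_test a b = tor (teq (var a) (var b)) (adjacent (var a) (var b))"

definition coloring_atom :: exp where
  "coloring_atom = tand (nbhd_test ''v'' ''u'')
     (tor (tneg (tand (nbhd_test ''v'' ''z'') (teq (Cell ''col'' (var ''z'')) (Cell ''col'' (var ''u'')))))
       (teq (var ''z'') (var ''u'')))"

definition coloring_test :: test where
  "coloring_test = Forall ''v'' (Exists ''u'' (Forall ''z'' (Atom coloring_atom)))"

text \<open>If \<open>R\<close> is nonzero after decoding, all colorings with \<open>k\<close> colors have already been tried.\<close>

definition step_com :: com where
  "step_com = Seq decode_com (Cond (var ''R'')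
     (Seq (Assign ''k'' (Const 0) (Add (var ''k'') (Const 1))) (Assign ''N'' (Const 0) (Const 0)))
     (Seq (decide coloring_test 0) (Cond (var ''r'') (Assign ''fnd'' (Const 0) (Const 1))
       (Assign ''N'' (Const 0) (Add (var ''N'') (Const 1))))))"

definition main_com :: com where
  "main_com = Seq row_com (Seq find_com (Seq (Assign ''X'' (var ''w'') (Const 1)) (Seq count_com
     (Seq twins_com (Seq (Assign ''k'' (Const 0) (Const 1)) (While (tneg (var ''fnd'')) step_com))))))"

text \<open>The adjacency cells must be exactly 0 or 1, since \<open>twins_test\<close> compares
  them for equality; cells of \<open>X\<close> are only tested for being nonzero.\<close>

definition represents :: "nat \<Rightarrow> nat pair_pre_digraph \<Rightarrow> nat set \<Rightarrow> mem \<Rightarrow> bool" where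
  "represents n G X s \<longleftrightarrow> s ''n'' 0 = n \<and>
     (\<forall>u<n. \<forall>v<n. s ''adj'' (s ''row'' u + v) = of_bool ((u, v) \<in> parcs G)) \<and>
     (\<forall>v<n. s ''X'' v \<noteq> 0 \<longleftrightarrow> v \<in> X)"

lemma represents_cong:
  "represents n G X s \<Longrightarrow> s' ''n'' = s ''n'' \<Longrightarrow> s' ''adj'' = s ''adj'' \<Longrightarrow> s' ''row'' = s ''row'' \<Longrightarrow>
     s' ''X'' = s ''X'' \<Longrightarrow> represents n G X s'"
  by (simp add: represents_def)

lemma represents_agree:
  "represents n G X s \<Longrightarrow> agree_off M s s' \<Longrightarrow>
     M \<inter> {''n'', ''adj'', ''row'', ''X''} = {} \<Longrightarrow> represents n G X s'"
  by (rule represents_cong) (auto simp: agree_off_def)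

section \<open>Correctness of the preparation: rows, dominating vertex, twins\<close>

lemma runs_row_com:
  assumes "s ''n'' 0 = n" "s ''row'' 0 = 0"
  shows "runs row_com s (5 * n + 2) (\<lambda>s'. \<forall>u\<le>n. s' ''row'' u = u * n)"
  unfolding row_com_def
proof (rule runs_For[where I = "\<lambda>j s'. \<forall>u\<le>j. s' ''row'' u = u * n" and B = 1])
  fix j s'
  assume "s' ''v'' 0 = j" "\<forall>u\<le>j. s' ''row'' u = u * n"
    and fr: "agree_off (insert ''v'' (assigned (Assign ''row'' (Add (var ''v'') (Const 1))
      (Add (Cell ''row'' (var ''v'')) (var ''n''))))) s s'"
  moreover have "s' ''n'' 0 = n"
    using agree_offD[OF fr, of "''n''"] assms by simp
  ultimately show "runs (Assign ''row'' (Add (var ''v'') (Const 1)) (Add (Cell ''row'' (var ''v'')) (var ''n''))) s' 1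
      (\<lambda>s'. \<forall>u\<le>Suc j. s' ''row'' u = u * n)"
    by (intro runs_Assign) (auto simp: le_Suc_eq)
next
  fix s'
  assume "agree_off (insert ''v'' (assigned (Assign ''row'' (Add (var ''v'') (Const 1))
      (Add (Cell ''row'' (var ''v'')) (var ''n''))))) s s'"
  then show "val (var ''n'') s' = n"
    using assms by (simp add: agree_off_def)
qed (use assms in auto)

lemma sat_dominates_test:
  assumes rep: "represents n G X s" and V: "pverts G = {..<n}" and v: "s ''v'' 0 < n"
  shows "sat dominates_test s \<longleftrightarrow> dominates_outside G X (s ''v'' 0)"
proof -
  define v where "v = s ''v'' 0"
  have "sat dominates_test s \<longleftrightarrow> (\<forall>u<n. \<forall>z<n. v \<notin> X \<and>
      (u \<in> X \<or> z \<in> X \<or> u = v \<or> (u, z) \<notin> parcs G \<or> (v, u) \<in> parcs G))"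
    using rep v by (auto simp: dominates_test_def represents_def v_def)
  then show ?thesis
    using v unfolding dominates_outside_def V v_def by (auto 4 3)
qed

lemma runs_find_com:
  assumes rep: "represents n G X s" and V: "pverts G = {..<n}" and ex: "\<exists>w. dominates_outside G X w"
  shows "runs find_com s (2 + n * (decide_time dominates_test n + 4)) (\<lambda>s'. dominates_outside G X (s' ''w'' 0))"
proof -
  let ?p = "Seq (decide dominates_test 0) (Cond (var ''r'') (Assign ''w'' (Const 0) (var ''v'')) Skip)"
  let ?I = "\<lambda>j s'. (\<exists>v<j. dominates_outside G X v) \<longrightarrow> dominates_outside G X (s' ''w'' 0)"
  have asg: "assigned ?p = {''u'', ''z'', ''r'', ''w''}"
    by (auto simp: dominates_test_def)
  have "runs find_com s (2 + n * (decide_time dominates_test n + 2 + 2)) (?I n)"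
    unfolding find_com_def
  proof (rule runs_For[where I = ?I])
    fix j s'
    assume j: "j < n" "s' ''v'' 0 = j" and fr: "agree_off (insert ''v'' (assigned ?p)) s s'" and I: "?I j s'"
    have rep': "represents n G X s'"
      by (rule represents_agree[OF rep fr]) (unfold asg, simp)
    show "runs ?p s' (decide_time dominates_test n + 2) (?I (Suc j))"
    proof (rule runs_Seq[where T' = 2])
      show "runs (decide dominates_test 0) s' (decide_time dominates_test n)
        (\<lambda>s''. runs (Cond (var ''r'') (Assign ''w'' (Const 0) (var ''v'')) Skip) s'' 2 (?I (Suc j)))"
      proof (rule runs_conseq[OF runs_decide])
        show "wf_test dominates_test"
          by (simp add: dominates_test_def)
        show "s' ''n'' 0 = n"
          using rep' by (simp add: represents_def)
        fix s''
        assume D: "decided dominates_test 0 s' s''" and fr': "agree_off (assigned (decide dominates_test 0)) s' s''"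
        have "s'' ''r'' 0 \<noteq> 0 \<longleftrightarrow> dominates_outside G X j"
          using D sat_dominates_test[OF rep' V] j by (simp add: decided_def)
        moreover have "s'' ''v'' 0 = j" "s'' ''w'' 0 = s' ''w'' 0"
          using fr' j by (simp_all add: agree_off_def dominates_test_def)
        ultimately show "runs (Cond (var ''r'') (Assign ''w'' (Const 0) (var ''v'')) Skip) s'' 2 (?I (Suc j))"
          using I by (intro runs_Cond[where T = 1] runs_Assign runs_Skip) (auto simp: less_Suc_eq)
      qed simp
    qed simp
  next
    fix s'
    assume "agree_off (insert ''v'' (assigned ?p)) s s'"
    then show "val (var ''n'') s' = n"
      using rep unfolding asg by (simp add: agree_off_def represents_def)
  next
    show "''v'' \<notin> assigned ?p"
      unfolding asg by simp
  qed auto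
  then show ?thesis
    by (rule runs_conseq) (use ex V in \<open>auto simp: dominates_outside_def add_mult_distrib2\<close>)
qed

lemma runs_count_com:
  assumes rep: "represents n G Y s" and dd: "s ''dd'' 0 = 0" and Y: "Y \<subseteq> {..<n}"
  shows "runs count_com s (2 + n * 4) (\<lambda>s'. s' ''dd'' 0 = card Y)"
proof -
  let ?p = "Cond (Cell ''X'' (var ''v'')) (Assign ''dd'' (Const 0) (Add (var ''dd'') (Const 1))) Skip"
  let ?I = "\<lambda>j s'. s' ''dd'' 0 = card (Y \<inter> {..<j})"
  have "runs count_com s (2 + n * 4) (?I n)"
    unfolding count_com_def
  proof (rule runs_For[where I = ?I and B = 2])
    fix j s'
    assume j: "j < n" "s' ''v'' 0 = j" and fr: "agree_off (insert ''v'' (assigned ?p)) s s'" and I: "?I j s'"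
    have "s' ''X'' j \<noteq> 0 \<longleftrightarrow> j \<in> Y"
      using fr rep j(1) by (simp add: agree_off_def represents_def)
    moreover have "Y \<inter> {..<Suc j} = (if j \<in> Y then insert j (Y \<inter> {..<j}) else Y \<inter> {..<j})"
      by (auto simp: less_Suc_eq)
    ultimately show "runs ?p s' 2 (?I (Suc j))"
      using I j(2) by (intro runs_Cond[where T = 1] runs_Assign runs_Skip) auto
  next
    fix s'
    assume "agree_off (insert ''v'' (assigned ?p)) s s'"
    then show "val (var ''n'') s' = n"
      using rep by (simp add: agree_off_def represents_def)
  qed (use dd in auto)
  moreover have "Y \<inter> {..<n} = Y"
    using Y by auto
  ultimately show ?thesis
    by simp
qed

lemma sat_twins_test:
  assumes rep: "represents n G Y s" and V: "pverts G = {..<n}" and Y: "Y \<subseteq> {..<n}"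
    and uv: "s ''u'' 0 < n" "s ''v'' 0 < n"
  shows "sat twins_test s \<longleftrightarrow> twins G Y (s ''u'' 0) (s ''v'' 0)"
proof -
  define u v where "u = s ''u'' 0" and "v = s ''v'' 0"
  have "sat twins_test s \<longleftrightarrow> (\<forall>x<n. u \<notin> Y \<and> v \<notin> Y \<and>
      (x \<notin> Y \<or> ((u, x) \<in> parcs G \<longleftrightarrow> (v, x) \<in> parcs G)))"
    using rep uv by (auto simp: twins_test_def represents_def u_def v_def)
  also have "\<dots> \<longleftrightarrow> u \<notin> Y \<and> v \<notin> Y \<and> (\<forall>x\<in>Y. (u, x) \<in> parcs G \<longleftrightarrow> (v, x) \<in> parcs G)"
  proof
    assume *: "\<forall>x<n. u \<notin> Y \<and> v \<notin> Y \<and> (x \<notin> Y \<or> ((u, x) \<in> parcs G \<longleftrightarrow> (v, x) \<in> parcs G))"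
    \<comment> \<open>Some \<open>x\<close> below \<open>n\<close> is needed to release the
      conjuncts about \<open>u\<close> and \<open>v\<close> from the quantifier.\<close>
    have "u < n"
      using uv(1) by (simp add: u_def)
    with * Y show "u \<notin> Y \<and> v \<notin> Y \<and> (\<forall>x\<in>Y. (u, x) \<in> parcs G \<longleftrightarrow> (v, x) \<in> parcs G)"
      by (meson lessThan_iff subsetD)
  qed blast
  also have "\<dots> \<longleftrightarrow> twins G Y u v"
  proof -
    have "closed_nbhd G z \<inter> Y = {x \<in> Y. (z, x) \<in> parcs G}" if "z \<notin> Y" for z
      using that by (auto simp: closed_nbhd_def)
    moreover have "u < n" "v < n"
      using uv by (simp_all add: u_def v_def)
    moreover have "{x \<in> Y. (u, x) \<in> parcs G} = {x \<in> Y. (v, x) \<in> parcs G} \<longleftrightarrow>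
        (\<forall>x\<in>Y. (u, x) \<in> parcs G \<longleftrightarrow> (v, x) \<in> parcs G)"
      by blast
    ultimately show ?thesis
      unfolding twins_def V by (simp cong: conj_cong)
  qed
  finally show ?thesis
    unfolding u_def v_def .
qed

definition ranked :: "nat pair_pre_digraph \<Rightarrow> nat set \<Rightarrow> nat \<Rightarrow> mem \<Rightarrow> bool" where
  "ranked G Y j s \<longleftrightarrow> (\<forall>v<j. s ''cnt'' v = rank G Y v \<and> (0 < rank G Y v \<longrightarrow> s ''par'' v = prev_twin G Y v))"

lemma runs_twins_com:
  assumes rep: "represents n G Y s" and V: "pverts G = {..<n}" and Y: "Y \<subseteq> {..<n}"
  shows "runs twins_com s (2 + n * (1 + (2 + n * (decide_time twins_test n + 3 + 2)) + 2)) (ranked G Y n)"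
proof -
  let ?q = "Seq (Assign ''par'' (var ''v'') (var ''u''))
    (Assign ''cnt'' (var ''v'') (Add (Cell ''cnt'' (var ''u'')) (Const 1)))"
  let ?p = "Seq (decide twins_test 0) (Cond (var ''r'') ?q Skip)"
  let ?b = "Seq (Assign ''cnt'' (var ''v'') (Const 0)) (For ''u'' (var ''v'') ?p)"
  let ?T = "decide_time twins_test n"
  have asg: "assigned ?p = {''x'', ''r'', ''par'', ''cnt''}"
    by (auto simp: twins_test_def)
  have asg': "assigned ?b = {''x'', ''r'', ''par'', ''cnt'', ''u''}"
    unfolding assigned.simps(3)[of "Assign _ _ _"] assigned_For asg by auto
  show ?thesis
    unfolding twins_com_def
  proof (rule runs_For[where I = "ranked G Y"])
    fix v s1
    assume v: "v < n" "s1 ''v'' 0 = v" and fr: "agree_off (insert ''v'' (assigned ?b)) s s1"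
      and ranked: "ranked G Y v s1"
    have rep1: "represents n G Y s1"
      by (rule represents_agree[OF rep fr]) (unfold asg', simp)
    let ?S = "\<lambda>i. {u. u < i \<and> twins G Y u v}"
    \<comment> \<open>The greatest twin found so far is described by its maximality, which avoids
      \<open>Max\<close> of a possibly empty set.\<close>
    let ?I = "\<lambda>i s'. ranked G Y v s' \<and> (?S i = {} \<longrightarrow> s' ''cnt'' v = 0) \<and>
      (\<forall>u \<in> ?S i. (\<forall>u' \<in> ?S i. u' \<le> u) \<longrightarrow> s' ''cnt'' v = Suc (rank G Y u) \<and> s' ''par'' v = u)"
    let ?s = "s1(''cnt'' := (s1 ''cnt'')(val (var ''v'') s1 := val (Const 0) s1))"
    have rep2: "represents n G Y ?s"
      using rep1 by (rule represents_cong) auto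
    have "runs (For ''u'' (var ''v'') ?p) ?s (2 + n * (?T + 3 + 2)) (?I v)"
    proof (rule runs_For[where I = ?I])
      show "?I 0 ?s"
        using ranked v by (simp add: ranked_def)
    next
      fix i s'
      assume i: "i < v" "s' ''u'' 0 = i" and fr': "agree_off (insert ''u'' (assigned ?p)) ?s s'" and I: "?I i s'"
      have rep': "represents n G Y s'"
        by (rule represents_agree[OF rep2 fr']) (unfold asg, simp)
      have v': "s' ''v'' 0 = v"
        using fr' v unfolding asg by (simp add: agree_off_def)
      show "runs ?p s' (?T + 3) (?I (Suc i))"
      proof (rule runs_Seq[where T' = 3])
        show "runs (decide twins_test 0) s' ?T (\<lambda>s''. runs (Cond (var ''r'') ?q Skip) s'' 3 (?I (Suc i)))"
        proof (rule runs_conseq[OF runs_decide])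
          show "wf_test twins_test"
            by (simp add: twins_test_def)
          show "s' ''n'' 0 = n"
            using rep' by (simp add: represents_def)
          fix s''
          assume D: "decided twins_test 0 s' s''" and fr2: "agree_off (assigned (decide twins_test 0)) s' s''"
          have r: "s'' ''r'' 0 \<noteq> 0 \<longleftrightarrow> twins G Y i v"
            using D sat_twins_test[OF rep' V Y] i v(1) v' by (simp add: decided_def)
          have eqs: "s'' ''v'' 0 = v" "s'' ''u'' 0 = i" "s'' ''cnt'' = s' ''cnt''" "s'' ''par'' = s' ''par''"
            using fr2 v' i(2) by (simp_all add: agree_off_def twins_test_def)
          show "runs (Cond (var ''r'') ?q Skip) s'' 3 (?I (Suc i))"
          proof (rule runs_Cond[where T = 2])
            assume "val (var ''r'') s'' \<noteq> 0"
            then have tw: "twins G Y i v"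
              using r by simp
            then have S: "?S (Suc i) = insert i (?S i)"
              by (auto simp: less_Suc_eq)
            have "s'' ''cnt'' i = rank G Y i"
              using I i(1) eqs by (simp add: ranked_def)
            moreover have "u = i" if "u \<in> ?S (Suc i)" "\<forall>u' \<in> ?S (Suc i). u' \<le> u" for u
              using that tw by (auto simp: less_Suc_eq)
            ultimately show "runs ?q s'' 2 (?I (Suc i))"
              using I i(1) eqs S
              by (intro runs_Seq[where T = 1 and T' = 1] runs_Assign) (auto simp: ranked_def)
          next
            assume "val (var ''r'') s'' = 0"
            then have "\<not> twins G Y i v"
              using r by simp
            then have S: "?S (Suc i) = ?S i"
              by (auto simp: less_Suc_eq)
            show "runs Skip s'' 2 (?I (Suc i))"
              unfolding S using I eqs by (intro runs_Skip) (auto simp: ranked_def)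
          qed simp
        qed simp
      qed simp
    next
      fix i s' x
      assume "?I i s'"
      then show "?I i (s'(''u'' := (s' ''u'')(0 := x)))"
        by (simp add: ranked_def)
    next
      fix s'
      assume "agree_off (insert ''u'' (assigned ?p)) ?s s'"
      then show "val (var ''v'') s' = v"
        using v(2) unfolding asg by (simp add: agree_off_def)
    next
      show "''u'' \<notin> assigned ?p"
        unfolding asg by simp
    next
      show "2 + v * (?T + 3 + 2) \<le> 2 + n * (?T + 3 + 2)"
        using v(1) by (intro add_left_mono mult_right_mono) auto
    qed
    then have "runs (For ''u'' (var ''v'') ?p) ?s (2 + n * (?T + 3 + 2)) (ranked G Y (Suc v))"
    proof (rule runs_conseq)
      fix s'
      assume I: "?I v s'"
      have S: "?S v = earlier_twins G Y v"
        by (simp add: earlier_twins_def)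
      have "s' ''cnt'' v = rank G Y v \<and> (0 < rank G Y v \<longrightarrow> s' ''par'' v = prev_twin G Y v)"
      proof (cases "rank G Y v = 0")
        case True
        then have "earlier_twins G Y v = {}"
          by (simp add: rank_def)
        then show ?thesis
          using I S True by simp
      next
        case False
        then have p: "prev_twin G Y v \<in> ?S v"
          unfolding S using prev_twin_in by simp
        have "\<forall>u' \<in> ?S v. u' \<le> prev_twin G Y v"
          unfolding S by (simp add: prev_twin_def)
        with p I have "s' ''cnt'' v = Suc (rank G Y (prev_twin G Y v)) \<and> s' ''par'' v = prev_twin G Y v"
          by blast
        then show ?thesis
          using rank_prev_twin[of G Y v] False by simp
      qed
      then show "ranked G Y (Suc v) s'"
        using I by (auto simp: ranked_def less_Suc_eq)
    qed simp
    then show "runs ?b s1 (1 + (2 + n * (?T + 3 + 2))) (ranked G Y (Suc v))"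
      by (intro runs_Seq[where T = 1] runs_Assign) auto
  next
    fix s'
    assume "agree_off (insert ''v'' (assigned ?b)) s s'"
    then show "val (var ''n'') s' = n"
      using rep unfolding asg' by (simp add: agree_off_def represents_def)
  next
    show "''v'' \<notin> assigned ?b"
      unfolding asg' by simp
  qed (auto simp: ranked_def)
qed

section \<open>Decoding and checking a coloring\<close>

lemma runs_div_com:
  assumes "0 < s ''k'' 0"
  shows "runs div_com s (2 + 3 * s ''R'' 0)
    (\<lambda>s'. s' ''R'' 0 = s ''R'' 0 mod s ''k'' 0 \<and> s' ''q'' 0 = s ''R'' 0 div s ''k'' 0)"
proof -
  define K N where "K = s ''k'' 0" and "N = s ''R'' 0"
  let ?s = "s(''q'' := (s ''q'')(val (Const 0) s := val (Const 0) s))"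
  let ?p = "Seq (Assign ''R'' (Const 0) (Sub (var ''R'') (var ''k''))) (Assign ''q'' (Const 0) (Add (var ''q'') (Const 1)))"
  let ?e = "tneg (Sub (var ''k'') (var ''R''))"
  let ?I = "\<lambda>s'. s' ''k'' 0 = K \<and> s' ''R'' 0 + s' ''q'' 0 * K = N"
  have e: "val ?e s' \<noteq> 0 \<longleftrightarrow> s' ''k'' 0 \<le> s' ''R'' 0" for s'
    using holds_simps(1)[of "Sub (var ''k'') (var ''R'')" s'] by (simp add: holds_def tneg_def)
  have "runs (While ?e ?p) ?s (1 + 3 * N) (\<lambda>s'. ?I s' \<and> val ?e s' = 0)"
  proof (rule runs_While[where \<mu> = "\<lambda>s'. s' ''R'' 0" and B = 2])
    show "?I ?s"
      by (simp add: K_def N_def)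
    show "runs ?p s' 2 (\<lambda>s''. ?I s'' \<and> s'' ''R'' 0 < s' ''R'' 0)" if "?I s'" "val ?e s' \<noteq> 0" for s'
      using that assms unfolding e
      by (intro runs_Seq[where T = 1 and T' = 1] runs_Assign) (auto simp: K_def)
  qed (simp add: N_def)
  then have "runs (While ?e ?p) ?s (1 + 3 * N) (\<lambda>s'. s' ''R'' 0 = N mod K \<and> s' ''q'' 0 = N div K)"
  proof (rule runs_conseq)
    fix s'
    assume "?I s' \<and> val ?e s' = 0"
    moreover have "\<not> s' ''k'' 0 \<le> s' ''R'' 0 \<longleftrightarrow> val ?e s' = 0"
      using e[of s'] by blast
    ultimately have R: "s' ''R'' 0 < K" "N = s' ''R'' 0 + s' ''q'' 0 * K"
      by auto
    then show "s' ''R'' 0 = N mod K \<and> s' ''q'' 0 = N div K"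
      by simp
  qed simp
  then show ?thesis
    unfolding div_com_def K_def N_def by (intro runs_Seq[where T = 1] runs_Assign) auto
qed

lemma assigned_div_com [simp]: "assigned div_com = {''q'', ''R''}"
  by (auto simp: div_com_def)

lemma runs_decode_com:
  assumes n: "s ''n'' 0 = n" and dd: "s ''dd'' 0 = card Y" and ranked: "ranked G Y n s" and V: "pverts G = {..<n}"
    and K: "s ''k'' 0 = K" "0 < K" and N: "s ''N'' 0 = N" "N \<le> P"
  shows "runs decode_com s (3 + n * (7 + 3 * P))
    (\<lambda>s'. s' ''R'' 0 = N div K ^ card (free_verts G Y) \<and> decodes G Y K N n (s' ''col''))"
proof -
  let ?F = "free_verts G Y"
  let ?p = "Seq div_com (Seq (Assign ''col'' (var ''v'') (Add (var ''R'') (Const 1))) (Assign ''R'' (Const 0) (var ''q'')))"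
  let ?q = "Assign ''col'' (var ''v'') (Cell ''col'' (Cell ''par'' (var ''v'')))"
  let ?e = "tneg (Sub (Cell ''cnt'' (var ''v'')) (var ''dd''))"
  let ?b = "Cond ?e ?p ?q"
  let ?I = "\<lambda>j s'. s' ''R'' 0 = N div K ^ card (?F \<inter> {..<j}) \<and> decodes G Y K N j (s' ''col'')"
  let ?s = "s(''R'' := (s ''R'')(val (Const 0) s := val (var ''N'') s))"
  have finF: "finite ?F" and Fn: "?F \<inter> {..<n} = ?F"
    by (auto simp: free_verts_def V)
  \<comment> \<open>A copied color comes from a smaller vertex, so writing entry \<open>j\<close>
    cannot spoil the equations for the vertices before it.\<close>
  have extend: "decodes G Y K N (Suc j) (C(j := c))"
    if "decodes G Y K N j C" "c = (if rank G Y j \<le> card Y then N div K ^ card (?F \<inter> {..<j}) mod K + 1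
      else C (prev_twin G Y j))" for j C c
  proof -
    have prev: "prev_twin G Y v < v" if "\<not> rank G Y v \<le> card Y" for v
      using prev_twin_in[of G Y v] that by (auto simp: earlier_twins_def)
    show ?thesis
      unfolding decodes_def
    proof (intro allI impI)
      fix v
      assume "v < Suc j"
      then consider "v < j" | "v = j"
        by linarith
      then show "(C(j := c)) v = (if rank G Y v \<le> card Y then N div K ^ card (?F \<inter> {..<v}) mod K + 1
          else (C(j := c)) (prev_twin G Y v))"
      proof cases
        case 1
        then show ?thesis
          using that(1) prev[of v] by (auto simp: decodes_def)
      next
        case 2
        then show ?thesis
          using that(2) prev[of v] by auto
      qed
    qed
  qed
  have "runs (For ''v'' (var ''n'') ?b) ?s (2 + n * (5 + 3 * P + 2)) (?I n)"
  proof (rule runs_For[where I = ?I])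
    show "?I 0 ?s"
      using N by (simp add: decodes_def)
  next
    fix j s'
    assume j: "j < n" "s' ''v'' 0 = j" and fr: "agree_off (insert ''v'' (assigned ?b)) ?s s'" and I: "?I j s'"
    have eqs: "s' ''cnt'' = s ''cnt''" "s' ''dd'' = s ''dd''" "s' ''k'' = s ''k''" "s' ''par'' = s ''par''"
      using fr by (simp_all add: agree_off_def)
    have e: "val ?e s' \<noteq> 0 \<longleftrightarrow> rank G Y j \<le> card Y"
      using holds_simps(1)[of "Sub (Cell ''cnt'' (var ''v'')) (var ''dd'')" s'] eqs j ranked dd
      by (simp add: holds_def ranked_def)
    show "runs ?b s' (5 + 3 * P) (?I (Suc j))"
    proof (rule runs_Cond[where T = "4 + 3 * P"])
      assume "val ?e s' \<noteq> 0"
      then have rk: "rank G Y j \<le> card Y"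
        using e by simp
      then have "?F \<inter> {..<Suc j} = insert j (?F \<inter> {..<j})"
        using j by (auto simp: free_verts_def V less_Suc_eq)
      then have card: "card (?F \<inter> {..<Suc j}) = Suc (card (?F \<inter> {..<j}))"
        using finF by simp
      show "runs ?p s' (4 + 3 * P) (?I (Suc j))"
      proof (rule runs_Seq[where T' = 2], rule runs_conseq[OF runs_div_com])
        show "0 < s' ''k'' 0"
          using eqs K by simp
        show "2 + 3 * s' ''R'' 0 \<le> 2 + 3 * P"
          using I le_trans[OF div_le_dividend[of N "K ^ card (?F \<inter> {..<j})"] N(2)] by simp
        fix s''
        assume D: "s'' ''R'' 0 = s' ''R'' 0 mod s' ''k'' 0 \<and> s'' ''q'' 0 = s' ''R'' 0 div s' ''k'' 0"
          and fr': "agree_off (assigned div_com) s' s''"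
        have eqs': "s'' ''v'' 0 = j" "s'' ''col'' = s' ''col''"
          using fr' j by (simp_all add: agree_off_def)
        have "decodes G Y K N (Suc j) ((s'' ''col'')(j := Suc (s'' ''R'' 0)))"
          by (rule extend) (use I D eqs' eqs K rk in auto)
        moreover have "s'' ''q'' 0 = N div K ^ card (?F \<inter> {..<Suc j})"
          unfolding card using D I eqs K by (simp add: mult.commute[of K] flip: div_mult2_eq)
        ultimately show "runs (Seq (Assign ''col'' (var ''v'') (Add (var ''R'') (Const 1))) (Assign ''R'' (Const 0) (var ''q'')))
            s'' 2 (?I (Suc j))"
          using eqs' by (intro runs_Seq[where T = 1 and T' = 1] runs_Assign) auto
      qed simp
    next
      assume "val ?e s' = 0"
      then have rk: "\<not> rank G Y j \<le> card Y"
        using e by auto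
      then have F: "?F \<inter> {..<Suc j} = ?F \<inter> {..<j}"
        by (auto simp: free_verts_def less_Suc_eq)
      have "s' ''par'' j = prev_twin G Y j"
        using ranked j rk eqs by (simp add: ranked_def)
      then have "decodes G Y K N (Suc j) ((s' ''col'')(j := s' ''col'' (s' ''par'' j)))"
        by (intro extend) (use I rk in auto)
      then show "runs ?q s' (4 + 3 * P) (?I (Suc j))"
        using I j F by (intro runs_Assign) auto
    qed simp
  next
    fix s'
    assume "agree_off (insert ''v'' (assigned ?b)) ?s s'"
    then show "val (var ''n'') s' = n"
      using n by (simp add: agree_off_def)
  qed auto
  then show ?thesis
    unfolding decode_com_def Fn by (intro runs_Seq[where T = 1 and T' = "2 + n * (5 + 3 * P + 2)"] runs_Assign) auto
qed

text \<open>Separated from the color range because the program tests only this condition; decoded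
  colorings lie in the range automatically.\<close>

definition conflict_free :: "nat pair_pre_digraph \<Rightarrow> (nat \<Rightarrow> nat) \<Rightarrow> bool" where
  "conflict_free G C \<longleftrightarrow> (\<forall>v \<in> pverts G. has_unique_color C (closed_nbhd G v))"

lemma closed_nbhd_subset: "pair_graph G \<Longrightarrow> v \<in> pverts G \<Longrightarrow> closed_nbhd G v \<subseteq> pverts G"
  using pair_graph_facts(3) by (auto simp: closed_nbhd_def)

lemma conflict_free_cong:
  assumes "pair_graph G" and "\<And>v. v \<in> pverts G \<Longrightarrow> C v = C' v"
  shows "conflict_free G C = conflict_free G C'"
  unfolding conflict_free_def
proof (rule ball_cong[OF refl])
  fix v
  assume "v \<in> pverts G"
  then show "has_unique_color C (closed_nbhd G v) = has_unique_color C' (closed_nbhd G v)"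
    using closed_nbhd_subset[OF assms(1)] assms(2) by (intro has_unique_color_cong) auto
qed

lemma sat_coloring_test:
  assumes G: "pair_graph G" and V: "pverts G = {..<n}" and rep: "represents n G Y s"
  shows "sat coloring_test s \<longleftrightarrow> conflict_free G (s ''col'')"
proof -
  define A where "A v z \<longleftrightarrow> v = z \<or> s ''adj'' (s ''row'' v + z) \<noteq> 0" for v z
  have A: "z \<in> closed_nbhd G v \<longleftrightarrow> z < n \<and> A v z" if "v < n" for v z
  proof (cases "z < n")
    case True
    then have "s ''adj'' (s ''row'' v + z) = of_bool ((v, z) \<in> parcs G)"
      using rep that by (simp add: represents_def)
    then show ?thesis
      using True by (auto simp: A_def closed_nbhd_def)
  next
    case False
    then show ?thesis
      using closed_nbhd_subset[OF G, of v] that unfolding V by auto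
  qed
  have "holds coloring_atom (s(''v'' := (s ''v'')(0 := v), ''u'' := (s ''u'')(0 := u), ''z'' := (s ''z'')(0 := z))) \<longleftrightarrow>
      A v u \<and> (\<not> (A v z \<and> s ''col'' z = s ''col'' u) \<or> z = u)" for v u z
    by (simp add: coloring_atom_def nbhd_test_def A_def)
  moreover have "s ''n'' 0 = n"
    using rep by (simp add: represents_def)
  ultimately have "sat coloring_test s \<longleftrightarrow> (\<forall>v<n. \<exists>u<n. \<forall>z<n. A v u \<and>
      (\<not> (A v z \<and> s ''col'' z = s ''col'' u) \<or> z = u))"
    by (simp add: coloring_test_def)
  also have "\<dots> \<longleftrightarrow> (\<forall>v<n. \<exists>u \<in> closed_nbhd G v. \<forall>z \<in> closed_nbhd G v. s ''col'' z = s ''col'' u \<longrightarrow> z = u)"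
  proof (intro all_cong1 imp_cong refl)
    fix v
    assume v: "v < n"
    show "(\<exists>u<n. \<forall>z<n. A v u \<and> (\<not> (A v z \<and> s ''col'' z = s ''col'' u) \<or> z = u)) \<longleftrightarrow>
      (\<exists>u \<in> closed_nbhd G v. \<forall>z \<in> closed_nbhd G v. s ''col'' z = s ''col'' u \<longrightarrow> z = u)"
    proof
      assume "\<exists>u<n. \<forall>z<n. A v u \<and> (\<not> (A v z \<and> s ''col'' z = s ''col'' u) \<or> z = u)"
      then obtain u where "u < n" "\<And>z. z < n \<Longrightarrow> A v u \<and> (\<not> (A v z \<and> s ''col'' z = s ''col'' u) \<or> z = u)"
        by blast
      then show "\<exists>u \<in> closed_nbhd G v. \<forall>z \<in> closed_nbhd G v. s ''col'' z = s ''col'' u \<longrightarrow> z = u"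
        using A[OF v] by (intro bexI[of _ u]) auto
    next
      assume "\<exists>u \<in> closed_nbhd G v. \<forall>z \<in> closed_nbhd G v. s ''col'' z = s ''col'' u \<longrightarrow> z = u"
      then obtain u where "u \<in> closed_nbhd G v" "\<And>z. z \<in> closed_nbhd G v \<Longrightarrow> s ''col'' z = s ''col'' u \<Longrightarrow> z = u"
        by blast
      then show "\<exists>u<n. \<forall>z<n. A v u \<and> (\<not> (A v z \<and> s ''col'' z = s ''col'' u) \<or> z = u)"
        using A[OF v] by (intro exI[of _ u]) auto
    qed
  qed
  finally show ?thesis
    unfolding conflict_free_def V has_unique_color_iff by (simp only: Ball_def lessThan_iff)
qed

lemma decodes_range:
  assumes "decodes G Y K N n C" "0 < K" "v < n"
  shows "C v \<in> {1..K}"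
  using assms(3)
proof (induction v rule: less_induct)
  case (less v)
  show ?case
  proof (cases "rank G Y v \<le> card Y")
    case True
    then have "C v = N div K ^ card (free_verts G Y \<inter> {..<v}) mod K + 1"
      using assms(1) less.prems by (auto simp: decodes_def)
    then show ?thesis
      using mod_less_divisor[OF assms(2), of "N div K ^ card (free_verts G Y \<inter> {..<v})"] by simp
  next
    case False
    then have "prev_twin G Y v < v"
      using prev_twin_in[of G Y v] by (simp add: earlier_twins_def)
    moreover have "C v = C (prev_twin G Y v)"
      using assms(1) less.prems False by (auto simp: decodes_def)
    ultimately show ?thesis
      using less by simp
  qed
qed

section \<open>The search loop\<close>

definition prepared :: "nat \<Rightarrow> nat pair_pre_digraph \<Rightarrow> nat set \<Rightarrow> mem \<Rightarrow> bool" where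
  "prepared n G Y s \<longleftrightarrow> represents n G Y s \<and> s ''dd'' 0 = card Y \<and> ranked G Y n s"

lemma assigned_decode_com: "assigned decode_com = {''R'', ''v'', ''q'', ''col''}"
  by (auto simp: decode_com_def)

lemma assigned_coloring_test: "assigned (decide coloring_test 0) = {''r'', ''v'', ''u'', ''z''}"
  by (auto simp: coloring_test_def)

lemma assigned_step_com:
  "assigned step_com = {''R'', ''v'', ''q'', ''col'', ''r'', ''u'', ''z'', ''k'', ''N'', ''fnd''}"
  unfolding step_com_def assigned.simps assigned_decode_com assigned_coloring_test by auto

lemma prepared_step: "prepared n G Y s \<Longrightarrow> agree_off (assigned step_com) s s' \<Longrightarrow> prepared n G Y s'"
  unfolding assigned_step_com by (simp add: prepared_def represents_def ranked_def agree_off_def)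

definition step_time :: "nat \<Rightarrow> nat \<Rightarrow> nat" where
  "step_time n P = 3 + n * (7 + 3 * P) + (decide_time coloring_test n + 5)"

lemma runs_step_com:
  assumes G: "pair_graph G" and V: "pverts G = {..<n}" and prep: "prepared n G Y s"
    and K: "s ''k'' 0 = K" "0 < K" and N: "s ''N'' 0 = N" "N \<le> P" and fnd: "s ''fnd'' 0 = 0"
  defines "m \<equiv> card (free_verts G Y)"
  shows "runs step_com s (step_time n P) (\<lambda>s'. prepared n G Y s' \<and>
    (if K ^ m \<le> N then s' ''k'' 0 = K + 1 \<and> s' ''N'' 0 = 0 \<and> s' ''fnd'' 0 = 0
     else s' ''k'' 0 = K \<and> decodes G Y K N n (s' ''col'') \<and>
       (if conflict_free G (s' ''col'') then s' ''fnd'' 0 = 1 \<and> s' ''N'' 0 = N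
        else s' ''fnd'' 0 = 0 \<and> s' ''N'' 0 = N + 1)))"
    (is "runs _ _ _ (\<lambda>s'. _ \<and> ?Q s')")
proof -
  let ?check = "Seq (decide coloring_test 0) (Cond (var ''r'') (Assign ''fnd'' (Const 0) (Const 1))
       (Assign ''N'' (Const 0) (Add (var ''N'') (Const 1))))"
  let ?next = "Seq (Assign ''k'' (Const 0) (Add (var ''k'') (Const 1))) (Assign ''N'' (Const 0) (Const 0))"
  have prep': "represents n G Y s" "s ''dd'' 0 = card Y" "ranked G Y n s" "s ''n'' 0 = n"
    using prep by (simp_all add: prepared_def represents_def)
  have "runs step_com s (step_time n P) ?Q"
    unfolding step_com_def
  proof (rule runs_Seq[where T' = "decide_time coloring_test n + 5"])
    show "runs decode_com s (3 + n * (7 + 3 * P))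
      (\<lambda>s'. runs (Cond (var ''R'') ?next ?check) s' (decide_time coloring_test n + 5) ?Q)"
    proof (rule runs_conseq[OF runs_decode_com[OF prep'(4,2,3) V K N]])
      fix s'
      assume D: "s' ''R'' 0 = N div K ^ card (free_verts G Y) \<and> decodes G Y K N n (s' ''col'')"
        and fr: "agree_off (assigned decode_com) s s'"
      have eqs: "s' ''k'' = s ''k''" "s' ''N'' = s ''N''" "s' ''fnd'' = s ''fnd''"
        using fr by (simp_all add: agree_off_def assigned_decode_com)
      have rep': "represents n G Y s'"
        by (rule represents_agree[OF prep'(1) fr]) (simp add: assigned_decode_com)
      have R: "s' ''R'' 0 \<noteq> 0 \<longleftrightarrow> K ^ m \<le> N"
        using D K(2) by (simp add: m_def div_eq_0_iff not_less)
      show "runs (Cond (var ''R'') ?next ?check) s' (decide_time coloring_test n + 5) ?Q"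
      proof (rule runs_Cond[where T = "decide_time coloring_test n + 4"])
        assume "val (var ''R'') s' \<noteq> 0"
        then have "K ^ m \<le> N"
          using R by simp
        then show "runs ?next s' (decide_time coloring_test n + 4) ?Q"
          using eqs K fnd by (intro runs_Seq[where T = 1 and T' = 1] runs_Assign) auto
      next
        assume "val (var ''R'') s' = 0"
        then have not: "\<not> K ^ m \<le> N"
          using R by simp
        show "runs ?check s' (decide_time coloring_test n + 4) ?Q"
        proof (rule runs_Seq[where T' = 4])
          show "runs (decide coloring_test 0) s' (decide_time coloring_test n)
            (\<lambda>s''. runs (Cond (var ''r'') (Assign ''fnd'' (Const 0) (Const 1))
              (Assign ''N'' (Const 0) (Add (var ''N'') (Const 1)))) s'' 4 ?Q)"
          proof (rule runs_conseq[OF runs_decide])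
            show "wf_test coloring_test"
              by (simp add: coloring_test_def coloring_atom_def nbhd_test_def)
            show "s' ''n'' 0 = n"
              using rep' by (simp add: represents_def)
            fix s''
            assume E: "decided coloring_test 0 s' s''"
              and fr': "agree_off (assigned (decide coloring_test 0)) s' s''"
            have eqs': "s'' ''k'' = s ''k''" "s'' ''N'' = s ''N''" "s'' ''fnd'' = s ''fnd''" "s'' ''col'' = s' ''col''"
              using fr' eqs unfolding assigned_coloring_test by (simp_all add: agree_off_def)
            have "s'' ''r'' 0 \<noteq> 0 \<longleftrightarrow> conflict_free G (s' ''col'')"
              using E sat_coloring_test[OF G V rep'] by (simp add: decided_def)
            then show "runs (Cond (var ''r'') (Assign ''fnd'' (Const 0) (Const 1))
                (Assign ''N'' (Const 0) (Add (var ''N'') (Const 1)))) s'' 4 ?Q"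
              using not eqs' K N fnd D by (intro runs_Cond[where T = 1] runs_Assign) auto
          qed simp
        qed simp
      qed simp
    qed simp
  qed (simp add: step_time_def)
  then show ?thesis
    by (rule runs_conseq) (use prepared_step[OF prep] in auto)
qed

text \<open>Let \<open>N0\<close> be the code of the reduced coloring \<open>C\<close> in base
  \<open>K0\<close>. Once \<open>k\<close> equals \<open>K0\<close>, the counter cannot pass
  \<open>N0\<close>, since the coloring decoded there is accepted; and as \<open>N0\<close> has no
  excess digits, \<open>k\<close> is not increased again. An earlier success is just as good, since
  every accepted coloring is valid.\<close>

lemma runs_search:
  assumes G: "pair_graph G" and V: "pverts G = {..<n}" and prep: "prepared n G Y s"
    and start: "s ''k'' 0 = 1" "s ''N'' 0 = 0" "s ''fnd'' 0 = 0"
    and red: "reduced G Y C" and col: "cf_cn_coloring G K0 C" and K0: "0 < K0"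
  defines "P \<equiv> K0 ^ card (free_verts G Y)"
  shows "runs (While (tneg (var ''fnd'')) step_com) s (1 + (K0 * (P + 2) + P) * (step_time n P + 1))
    (\<lambda>s'. s' ''k'' 0 \<le> K0 \<and> cf_cn_coloring G (s' ''k'' 0) (s' ''col''))"
proof -
  define m where "m = card (free_verts G Y)"
  have P: "P = K0 ^ m"
    by (simp add: P_def m_def)
  obtain N0 where N0: "N0 < P" "\<And>C'. decodes G Y K0 N0 n C' \<Longrightarrow> \<forall>v<n. C' v = C v"
    using decode_reduced[OF V red K0] col by (auto simp: cf_cn_coloring_def V P_def)
  have good: "conflict_free G C'" if "decodes G Y K0 N0 n C'" for C'
  proof -
    have "conflict_free G C' = conflict_free G C"
      using N0(2)[OF that] by (intro conflict_free_cong[OF G]) (simp add: V)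
    then show ?thesis
      using col by (simp add: conflict_free_def cf_cn_coloring_def)
  qed
  define I where "I s' \<longleftrightarrow> prepared n G Y s' \<and> 0 < s' ''k'' 0 \<and> s' ''k'' 0 \<le> K0 \<and> s' ''N'' 0 \<le> P \<and>
    (s' ''k'' 0 = K0 \<longrightarrow> s' ''N'' 0 \<le> N0) \<and>
    (s' ''fnd'' 0 \<noteq> 0 \<longrightarrow> cf_cn_coloring G (s' ''k'' 0) (s' ''col''))" for s'
  \<comment> \<open>Lexicographic order on \<open>k\<close> and \<open>N\<close> as a number:
    resetting \<open>N\<close> to 0 regains at most \<open>P + 1\<close>, less than the weight
    \<open>P + 2\<close> of one increment of \<open>k\<close>. It is positive as long as nothing is
    found, because \<open>N \<le> P\<close>.\<close>
  define \<mu> where "\<mu> s' = (if s' ''fnd'' 0 \<noteq> 0 then 0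
    else (K0 - s' ''k'' 0) * (P + 2) + (P + 1 - s' ''N'' 0))" for s' :: mem
  have e: "val (tneg (var ''fnd'')) s' \<noteq> 0 \<longleftrightarrow> s' ''fnd'' 0 = 0" for s'
    by (cases "s' ''fnd'' 0") (simp_all add: tneg_def)
  have "runs (While (tneg (var ''fnd'')) step_com) s (1 + (K0 * (P + 2) + P) * (step_time n P + 1))
    (\<lambda>s'. I s' \<and> val (tneg (var ''fnd'')) s' = 0)"
  proof (rule runs_While[where \<mu> = \<mu> and B = "step_time n P"])
    show "I s"
      using prep start K0 by (simp add: I_def)
  next
    fix s'
    assume I: "I s'" and "val (tneg (var ''fnd'')) s' \<noteq> 0"
    then have fnd: "s' ''fnd'' 0 = 0"
      using e by simp
    define K N where "K = s' ''k'' 0" and "N = s' ''N'' 0"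
    have K: "0 < K" "K \<le> K0" "N \<le> P" "K = K0 \<Longrightarrow> N \<le> N0" "prepared n G Y s'"
      using I by (auto simp: I_def K_def N_def)
    have Km: "K ^ m \<le> P"
      unfolding P using K(2) by (rule power_mono) simp
    show "runs step_com s' (step_time n P) (\<lambda>s''. I s'' \<and> \<mu> s'' < \<mu> s')"
    proof (rule runs_conseq[OF runs_step_com[OF G V K(5) K_def[symmetric] K(1) N_def[symmetric] K(3) fnd]])
      fix s''
      assume post: "prepared n G Y s'' \<and>
        (if K ^ card (free_verts G Y) \<le> N then s'' ''k'' 0 = K + 1 \<and> s'' ''N'' 0 = 0 \<and> s'' ''fnd'' 0 = 0
         else s'' ''k'' 0 = K \<and> decodes G Y K N n (s'' ''col'') \<and>
           (if conflict_free G (s'' ''col'') then s'' ''fnd'' 0 = 1 \<and> s'' ''N'' 0 = N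
            else s'' ''fnd'' 0 = 0 \<and> s'' ''N'' 0 = N + 1))"
      have \<mu>': "\<mu> s' = (K0 - K) * (P + 2) + (P + 1 - N)"
        using fnd by (simp add: \<mu>_def K_def N_def)
      consider "K ^ m \<le> N" | "\<not> K ^ m \<le> N" "conflict_free G (s'' ''col'')"
        | "\<not> K ^ m \<le> N" "\<not> conflict_free G (s'' ''col'')"
        by blast
      then show "I s'' \<and> \<mu> s'' < \<mu> s'"
      proof cases
        case 1
        then have s'': "s'' ''k'' 0 = K + 1" "s'' ''N'' 0 = 0" "s'' ''fnd'' 0 = 0"
          using post by (simp_all add: m_def)
        have "K \<noteq> K0"
        proof
          assume "K = K0"
          then show False
            using 1 K(4) N0(1) P by simp
        qed
        then have lt: "K < K0"
          using K(2) by simp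
        then obtain i where "K0 - K = Suc i"
          by (metis Suc_diff_Suc)
        moreover from this have "K0 - (K + 1) = i"
          by simp
        ultimately have "\<mu> s'' < \<mu> s'"
          unfolding \<mu>' using s'' by (simp add: \<mu>_def)
        then show ?thesis
          using s'' lt post by (simp add: I_def)
      next
        case 2
        then have s'': "s'' ''k'' 0 = K" "s'' ''N'' 0 = N" "s'' ''fnd'' 0 = 1" "decodes G Y K N n (s'' ''col'')"
          using post by (simp_all add: m_def)
        have "s'' ''col'' ` {..<n} \<subseteq> {1..K}"
          using decodes_range[OF s''(4) K(1)] by blast
        then have "cf_cn_coloring G K (s'' ''col'')"
          using 2(2) by (simp add: cf_cn_coloring_def conflict_free_def V)
        moreover have "\<mu> s'' < \<mu> s'"
          unfolding \<mu>' using s'' K(3) by (simp add: \<mu>_def)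
        ultimately show ?thesis
          using s'' K post by (simp add: I_def)
      next
        case 3
        then have s'': "s'' ''k'' 0 = K" "s'' ''N'' 0 = N + 1" "s'' ''fnd'' 0 = 0" "decodes G Y K N n (s'' ''col'')"
          using post by (simp_all add: m_def)
        have lt: "N < P"
          using 3(1) Km by simp
        have "N + 1 \<le> N0" if "K = K0"
          using K(4)[OF that] good[of "s'' ''col''"] s''(4) 3(2) that by (cases "N = N0") auto
        moreover have "\<mu> s'' < \<mu> s'"
          unfolding \<mu>' using s'' lt by (simp add: \<mu>_def)
        ultimately show ?thesis
          using s'' K lt post by (simp add: I_def)
      qed
    qed simp
  next
    have "\<mu> s = (K0 - 1) * (P + 2) + (P + 1)"
      using start by (simp add: \<mu>_def)
    also have "\<dots> \<le> K0 * (P + 2) + P"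
      using K0 by (cases K0) auto
    finally show "1 + \<mu> s * (step_time n P + 1) \<le> 1 + (K0 * (P + 2) + P) * (step_time n P + 1)"
      by (intro add_left_mono mult_right_mono) auto
  qed
  then show ?thesis
  proof (rule runs_conseq)
    fix s'
    assume *: "I s' \<and> val (tneg (var ''fnd'')) s' = 0"
    then have "s' ''fnd'' 0 \<noteq> 0"
      using e[of s'] by simp
    then show "s' ''k'' 0 \<le> K0 \<and> cf_cn_coloring G (s' ''k'' 0) (s' ''col'')"
      using * by (simp add: I_def)
  qed simp
qed

section \<open>The whole program\<close>

lemma assigned_row_com: "assigned row_com = {''v'', ''row''}"
  by (auto simp: row_com_def)

lemma assigned_find_com: "assigned find_com = {''v'', ''u'', ''z'', ''r'', ''w''}"
  by (auto simp: find_com_def dominates_test_def)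

lemma assigned_count_com: "assigned count_com = {''v'', ''dd''}"
  by (auto simp: count_com_def)

lemma assigned_twins_com: "assigned twins_com = {''v'', ''u'', ''x'', ''r'', ''par'', ''cnt''}"
  by (auto simp: twins_com_def twins_test_def)

definition main_time :: "nat \<Rightarrow> nat \<Rightarrow> nat \<Rightarrow> nat" where
  "main_time n K P = (5 * n + 2) + (2 + n * (decide_time dominates_test n + 4)) + 1 + (2 + n * 4) +
     (2 + n * (1 + (2 + n * (decide_time twins_test n + 3 + 2)) + 2)) + 1 +
     (1 + (K * (P + 2) + P) * (step_time n P + 1))"

lemma represents_graph_input:
  assumes V: "pverts G = {..<n}" and fr: "agree_off (assigned row_com) (graph_input n G X) s"
    and row: "\<forall>u\<le>n. s ''row'' u = u * n"
  shows "represents n G X s"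
proof -
  have eqs: "s ''n'' 0 = n" "s ''adj'' = (\<lambda>i. if i < n * n \<and> (i div n, i mod n) \<in> parcs G then 1 else 0)"
      "s ''X'' = (\<lambda>i. if i \<in> X then 1 else 0)"
    using fr by (simp_all add: agree_off_def assigned_row_com graph_input_def)
  have "u * n + v < n * n" if "u < n" "v < n" for u v
  proof -
    have "u * n + v < Suc u * n"
      using that(2) by simp
    also have "\<dots> \<le> n * n"
      using that(1) by (intro mult_right_mono) auto
    finally show ?thesis .
  qed
  then have "s ''adj'' (s ''row'' u + v) = of_bool ((u, v) \<in> parcs G)" if "u < n" "v < n" for u v
    using row that by (simp add: eqs(2))
  then show ?thesis
    by (simp add: represents_def eqs(1,3))
qed

lemma runs_main_com:
  assumes G: "pair_graph G" and V: "pverts G = {..<n}" and X: "X \<subseteq> pverts G" and n: "0 < n"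
    and thr: "threshold_graph (delete_verts G X)"
  shows "\<exists>m. m \<le> (card X + 1) + 2 ^ (card X + 1) * (card X + 2) \<and> chi_cf G \<le> card X + 2 \<and>
    runs main_com (graph_input n G X) (main_time n (chi_cf G + 1) ((chi_cf G + 1) ^ m))
    (\<lambda>s. s ''k'' 0 \<le> chi_cf G + 1 \<and> cf_cn_coloring G (s ''k'' 0) (s ''col''))"
proof -
  let ?Q = "\<lambda>s. s ''k'' 0 \<le> chi_cf G + 1 \<and> cf_cn_coloring G (s ''k'' 0) (s ''col'')"
  have ex: "\<exists>w. dominates_outside G X w"
    by (rule ex_dominates_outside[OF thr])
  have bounds: "card (free_verts G (insert w X)) \<le> (card X + 1) + 2 ^ (card X + 1) * (card X + 2)"
      "chi_cf G \<le> card X + 2" "\<exists>C. cf_cn_coloring G (chi_cf G + 1) C \<and> reduced G (insert w X) C"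
      "insert w X \<subseteq> {..<n}" "w < n"
    if w: "dominates_outside G X w" for w
  proof -
    have Y: "insert w X \<subseteq> pverts G"
      using w X by (simp add: dominates_outside_def)
    have fin: "finite X"
      using X pair_graph_facts(1)[OF G] by (rule finite_subset)
    have card: "card (insert w X) = card X + 1"
      using w fin by (simp add: dominates_outside_def)
    note near = dominates_outside_near[OF G w]
    show "card (free_verts G (insert w X)) \<le> (card X + 1) + 2 ^ (card X + 1) * (card X + 2)"
      using card_free_verts[OF pair_graph_facts(1)[OF G], of "insert w X"] fin unfolding card by simp
    obtain C where C: "cf_cn_coloring G (card X + 2) C"
      using ex_coloring_near[OF G Y near] unfolding card by auto
    show "chi_cf G \<le> card X + 2"
      by (rule chi_cf_le[OF C])
    have "\<exists>C. cf_cn_coloring G (chi_cf G) C"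
      unfolding chi_cf_def by (rule LeastI, rule exI[of _ C], rule C)
    then show "\<exists>C. cf_cn_coloring G (chi_cf G + 1) C \<and> reduced G (insert w X) C"
      using reduced_coloring[OF G Y near] by blast
    show "insert w X \<subseteq> {..<n}" "w < n"
      using Y V by auto
  qed
  \<comment> \<open>Which dominating vertex is chosen is known only after \<open>find_com\<close>
    has run, but the time bound has to be fixed before. So the maximum over all candidates is
    taken.\<close>
  define M where "M = Max ((\<lambda>w. card (free_verts G (insert w X))) ` {w. dominates_outside G X w})"
  have finW: "finite {w. dominates_outside G X w}"
    by (rule finite_subset[of _ "{..<n}"]) (use bounds(5) in auto)
  have M: "card (free_verts G (insert w X)) \<le> M" if "dominates_outside G X w" for w
    unfolding M_def using finW that by (intro Max_ge) auto
  have M_le: "M \<le> (card X + 1) + 2 ^ (card X + 1) * (card X + 2)"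
    unfolding M_def using finW ex bounds(1) by (subst Max_le_iff) auto
  define K P where "K = chi_cf G + 1" and "P = K ^ M"
  define S where "S = 1 + (K * (P + 2) + P) * (step_time n P + 1)"
  \<comment> \<open>Time budgets of the successive suffixes of the program, from the last one
    backwards.\<close>
  define T5 T4 T3 T2 T1 where "T5 = 1 + S" and "T4 = (2 + n * (1 + (2 + n * (decide_time twins_test n + 3 + 2)) + 2)) + T5"
    and "T3 = (2 + n * 4) + T4" and "T2 = 1 + T3" and "T1 = (2 + n * (decide_time dominates_test n + 4)) + T2"
  have main_time: "main_time n K P = (5 * n + 2) + T1"
    by (simp add: main_time_def T1_def T2_def T3_def T4_def T5_def S_def)
  have "runs main_com (graph_input n G X) (main_time n K P) ?Q"
    unfolding main_com_def main_time
  proof (rule runs_Seq_conseq[OF runs_row_com])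
    show "graph_input n G X ''n'' 0 = n" "graph_input n G X ''row'' 0 = 0"
      by (simp_all add: graph_input_def)
    let ?s0 = "graph_input n G X"
    fix s1
    assume row: "\<forall>u\<le>n. s1 ''row'' u = u * n" and fr1: "agree_off (assigned row_com) ?s0 s1"
    have rep1: "represents n G X s1"
      by (rule represents_graph_input[OF V fr1 row])
    have z1: "s1 ''dd'' = (\<lambda>i. 0)" "s1 ''N'' = (\<lambda>i. 0)" "s1 ''fnd'' = (\<lambda>i. 0)"
      using fr1 by (simp_all add: agree_off_def assigned_row_com graph_input_def)
    show "runs (Seq find_com (Seq (Assign ''X'' (var ''w'') (Const 1)) (Seq count_com
        (Seq twins_com (Seq (Assign ''k'' (Const 0) (Const 1)) (While (tneg (var ''fnd'')) step_com)))))) s1 T1 ?Q"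
    proof (rule runs_Seq_conseq[OF runs_find_com[OF rep1 V ex]])
      fix s2
      assume w: "dominates_outside G X (s2 ''w'' 0)" and fr2: "agree_off (assigned find_com) s1 s2"
      define Y where "Y = insert (s2 ''w'' 0) X"
      note bd = bounds[OF w, folded Y_def]
      have rep2: "represents n G X s2"
        by (rule represents_agree[OF rep1 fr2]) (simp add: assigned_find_com)
      have z2: "s2 ''dd'' = (\<lambda>i. 0)" "s2 ''N'' = (\<lambda>i. 0)" "s2 ''fnd'' = (\<lambda>i. 0)"
        using fr2 z1 by (simp_all add: agree_off_def assigned_find_com)
      let ?s3 = "s2(''X'' := (s2 ''X'')(s2 ''w'' 0 := 1))"
      have rep3: "represents n G Y ?s3"
        using rep2 by (auto simp: represents_def Y_def)
      have "runs (Seq count_com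
          (Seq twins_com (Seq (Assign ''k'' (Const 0) (Const 1)) (While (tneg (var ''fnd'')) step_com)))) ?s3 T3 ?Q"
      proof (rule runs_Seq_conseq[OF runs_count_com[OF rep3 _ bd(4)]])
        show "?s3 ''dd'' 0 = 0"
          using z2 by simp
        fix s4
        assume dd: "s4 ''dd'' 0 = card Y" and fr4: "agree_off (assigned count_com) ?s3 s4"
        have rep4: "represents n G Y s4"
          by (rule represents_agree[OF rep3 fr4]) (simp add: assigned_count_com)
        have z4: "s4 ''N'' = (\<lambda>i. 0)" "s4 ''fnd'' = (\<lambda>i. 0)"
          using fr4 z2 by (simp_all add: agree_off_def assigned_count_com)
        show "runs (Seq twins_com (Seq (Assign ''k'' (Const 0) (Const 1)) (While (tneg (var ''fnd'')) step_com))) s4 T4 ?Q"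
        proof (rule runs_Seq_conseq[OF runs_twins_com[OF rep4 V bd(4)]])
          fix s5
          assume ranked: "ranked G Y n s5" and fr5: "agree_off (assigned twins_com) s4 s5"
          have rep5: "represents n G Y s5"
            by (rule represents_agree[OF rep4 fr5]) (simp add: assigned_twins_com)
          have z5: "s5 ''N'' = (\<lambda>i. 0)" "s5 ''fnd'' = (\<lambda>i. 0)"
            using fr5 z4 by (simp_all add: agree_off_def assigned_twins_com)
          have dd5: "s5 ''dd'' 0 = card Y"
            using fr5 dd by (simp add: agree_off_def assigned_twins_com)
          let ?s6 = "s5(''k'' := (s5 ''k'')(0 := 1))"
          obtain C where C: "cf_cn_coloring G K C" "reduced G Y C"
            using bd(3) by (auto simp: K_def)
          let ?P = "K ^ card (free_verts G Y)"
          have "?P \<le> P"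
            unfolding P_def using M[OF w] by (intro power_increasing) (auto simp: Y_def K_def)
          then have T: "1 + (K * (?P + 2) + ?P) * (step_time n ?P + 1) \<le> 1 + (K * (P + 2) + P) * (step_time n P + 1)"
            by (intro add_left_mono mult_mono add_mono mult_left_mono) (simp_all add: step_time_def)
          have "prepared n G Y ?s6"
            using rep5 ranked dd5 by (simp add: prepared_def represents_def ranked_def)
          then have "runs (While (tneg (var ''fnd'')) step_com) ?s6
            (1 + (K * (?P + 2) + ?P) * (step_time n ?P + 1)) ?Q"
            by (intro runs_conseq[OF runs_search[OF G V _ _ _ _ C(2,1)]]) (use z5 in \<open>simp_all add: K_def\<close>)
          then have "runs (While (tneg (var ''fnd'')) step_com) ?s6 S ?Q"
            unfolding S_def by (rule runs_conseq) (use T in simp_all)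
          then show "runs (Seq (Assign ''k'' (Const 0) (Const 1)) (While (tneg (var ''fnd'')) step_com)) s5 T5 ?Q"
            by (intro runs_Assign_Seq[where T = S]) (simp_all add: T5_def)
        qed (simp_all add: T4_def)
      qed (simp_all add: T3_def)
      then show "runs (Seq (Assign ''X'' (var ''w'') (Const 1)) (Seq count_com
          (Seq twins_com (Seq (Assign ''k'' (Const 0) (Const 1)) (While (tneg (var ''fnd'')) step_com))))) s2 T2 ?Q"
        by (intro runs_Assign_Seq[where T = T3]) (simp_all add: T2_def)
    qed (simp_all add: T1_def)
  qed simp_all
  then show ?thesis
    using M_le ex bounds(2) unfolding K_def P_def by blast
qed

section \<open>Estimates for the running time\<close>

lemma main_time_le:
  assumes "0 < n"
  shows "main_time n K P \<le> 133 * n ^ 3 * ((K + 1) * (P + 1) ^ 2)"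
proof -
  obtain j where n: "n = Suc j"
    using assms by (cases n) auto
  \<comment> \<open>For \<open>n \<ge> 1\<close> a cubic polynomial is at most \<open>n ^ 3\<close>
    times the sum of its coefficients; that sum is 38 for the part free of \<open>P\<close>.\<close>
  have "step_time n P + 1 \<le> 38 * n ^ 3 * (P + 1)"
    unfolding step_time_def n by (simp add: coloring_test_def power3_eq_cube algebra_simps)
  moreover have "K * (P + 2) + P \<le> 2 * ((K + 1) * (P + 1))"
    by (simp add: algebra_simps)
  ultimately have "(K * (P + 2) + P) * (step_time n P + 1) \<le> 2 * ((K + 1) * (P + 1)) * (38 * n ^ 3 * (P + 1))"
    by (intro mult_mono) auto
  also have "\<dots> = 76 * n ^ 3 * ((K + 1) * (P + 1) ^ 2)"
    by (simp add: power2_eq_square algebra_simps)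
  \<comment> \<open>Likewise 57 is the sum of the coefficients of everything outside the rounds of
    the search, and 76 is twice 38.\<close>
  finally have "main_time n K P \<le> 57 * n ^ 3 + 76 * n ^ 3 * ((K + 1) * (P + 1) ^ 2)"
    unfolding main_time_def
    by (simp add: n dominates_test_def twins_test_def power3_eq_cube algebra_simps)
  also have "\<dots> \<le> 57 * n ^ 3 * ((K + 1) * (P + 1) ^ 2) + 76 * n ^ 3 * ((K + 1) * (P + 1) ^ 2)"
  proof (rule add_right_mono)
    have "1 \<le> (K + 1) * (P + 1) ^ 2"
      by (simp add: Suc_le_eq)
    then show "57 * n ^ 3 \<le> 57 * n ^ 3 * ((K + 1) * (P + 1) ^ 2)"
      using mult_left_mono[of 1 "(K + 1) * (P + 1) ^ 2" "57 * n ^ 3"] by simp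
  qed
  finally show ?thesis
    by simp
qed

text \<open>With \<open>a = 2 ^ d\<close> the number of digits \<open>m\<close> is at most
  \<open>8 * a ^ 2\<close> and \<open>K\<close> at most \<open>2 ^ (d + 2)\<close>, so
  \<open>K ^ m\<close> has an exponent cubic in \<open>a\<close>. The generous form on the right is
  easy to compute.\<close>

lemma search_bound:
  assumes m: "m \<le> (d + 1) + 2 ^ (d + 1) * (d + 2)" and K: "K \<le> d + 3"
  shows "133 * ((K + 1) * (K ^ m + 1) ^ 2) \<le> (2 ^ 2 ^ (3 * d + 9) :: nat)"
proof -
  define a :: nat where "a = 2 ^ d"
  \<comment> \<open>Large enough for the exponent \<open>(d + 2) * m \<le> 16 * a ^ 3\<close> and
    for \<open>K + 1\<close>. The whole product then has an exponent of at most
    \<open>3 * E + 10\<close>, and \<open>16 * E\<close> is a power of 2.\<close>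
  define E where "E = 32 * a ^ 3"
  have da: "d + 1 \<le> a"
    using less_exp[of d] by (simp add: a_def Suc_le_eq)
  then have a3: "a \<le> a ^ 3"
    using self_le_power[of a 3] by simp
  have pow: "2 ^ (3 * d + 9) = 16 * E"
  proof -
    have "(2::nat) ^ (3 * d + 9) = 2 ^ (d * 3) * 2 ^ 9"
      unfolding power_add by (simp only: mult.commute)
    also have "(2::nat) ^ (d * 3) = a ^ 3"
      unfolding a_def by (rule power_mult)
    finally show ?thesis
      by (simp add: E_def)
  qed
  have "m \<le> (d + 1) + 2 * a * (d + 2)"
    using m by (simp add: a_def)
  also have "\<dots> \<le> a + 2 * a * (a + 1)"
    by (rule add_mono[OF da mult_left_mono]) (use da in simp_all)
  also have "\<dots> = 3 * a + 2 * a ^ 2"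
    by (simp add: power2_eq_square algebra_simps)
  also have "\<dots> \<le> 8 * a ^ 2"
    using self_le_power[of a 2] da by simp
  finally have "(d + 2) * m \<le> (2 * a) * (8 * a ^ 2)"
    using da by (intro mult_mono) simp_all
  also have "\<dots> \<le> E"
    by (simp add: E_def power2_eq_square power3_eq_cube)
  finally have mE: "(d + 2) * m \<le> E" .
  have "K \<le> 2 ^ (d + 2)"
    using K da by (simp add: a_def)
  then have "K ^ m \<le> (2 ^ (d + 2)) ^ m"
    by (rule power_mono) simp
  also have "\<dots> = 2 ^ ((d + 2) * m)"
    by (rule power_mult[symmetric])
  also have "\<dots> \<le> 2 ^ E"
    using mE by (rule power_increasing) simp
  finally have "K ^ m + 1 \<le> 2 ^ E + 2 ^ E"
    using one_le_power[of "2::nat" E] by linarith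
  then have P: "K ^ m + 1 \<le> 2 ^ (E + 1)"
    by simp
  have "K + 1 \<le> E"
    using K da a3 unfolding E_def by linarith
  also have "\<dots> \<le> 2 ^ E"
    using less_exp[of E] by (rule less_imp_le)
  finally have K1: "K + 1 \<le> 2 ^ E" .
  have "133 * ((K + 1) * (K ^ m + 1) ^ 2) \<le> 2 ^ 8 * (2 ^ E * (2 ^ (E + 1)) ^ 2)"
    using K1 power_mono[OF P, of 2] by (intro mult_mono) simp_all
  also have "\<dots> = 2 ^ (8 + (E + (E + 1) * 2))"
    by (simp only: power_add power_mult)
  also have "\<dots> \<le> 2 ^ (16 * E)"
  proof (rule power_increasing)
    have "1 \<le> a ^ 3"
      using da a3 by linarith
    then show "8 + (E + (E + 1) * 2) \<le> 16 * E"
      by (simp add: E_def)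
  qed simp
  finally show ?thesis
    by (simp only: pow)
qed

section \<open>Computability of the double exponential\<close>

definition exp_com :: com where
  "exp_com = Seq (Assign ''y'' (Const 0) (Const 1)) (Seq
     (While (var ''x'') (Seq (Assign ''y'' (Const 0) (Add (var ''y'') (var ''y'')))
       (Assign ''x'' (Const 0) (Sub (var ''x'') (Const 1)))))
     (Assign ''x'' (Const 0) (var ''y'')))"

lemma runs_exp_com: "runs exp_com s (3 + 3 * s ''x'' 0) (\<lambda>s'. s' ''x'' 0 = 2 ^ s ''x'' 0)"
proof -
  define v where "v = s ''x'' 0"
  let ?s = "s(''y'' := (s ''y'')(val (Const 0) s := val (Const 1) s))"
  let ?p = "Seq (Assign ''y'' (Const 0) (Add (var ''y'') (var ''y''))) (Assign ''x'' (Const 0) (Sub (var ''x'') (Const 1)))"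
  let ?I = "\<lambda>s'. s' ''y'' 0 * 2 ^ s' ''x'' 0 = 2 ^ v"
  have "runs (While (var ''x'') ?p) ?s (1 + 3 * v) (\<lambda>s'. ?I s' \<and> val (var ''x'') s' = 0)"
  proof (rule runs_While[where \<mu> = "\<lambda>s'. s' ''x'' 0" and B = 2])
    show "?I ?s"
      by (simp add: v_def)
    show "runs ?p s' 2 (\<lambda>s''. ?I s'' \<and> s'' ''x'' 0 < s' ''x'' 0)" if I: "?I s'" "val (var ''x'') s' \<noteq> 0" for s'
    proof -
      obtain i where "s' ''x'' 0 = Suc i"
        using I(2) by (cases "s' ''x'' 0") auto
      then show ?thesis
        using I(1) by (intro runs_Seq[where T = 1 and T' = 1] runs_Assign) (auto simp: algebra_simps)
    qed
  qed (simp add: v_def)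
  then have "runs (While (var ''x'') ?p) ?s (1 + 3 * v)
    (\<lambda>s'. runs (Assign ''x'' (Const 0) (var ''y'')) s' 1 (\<lambda>s''. s'' ''x'' 0 = 2 ^ v))"
    by (rule runs_conseq) (auto intro: runs_Assign)
  then show ?thesis
    unfolding exp_com_def v_def by (intro runs_Seq[where T = 1] runs_Assign runs_Seq[where T' = 1]) auto
qed

text \<open>\<open>exp_com\<close> leaves its result in the variable of its argument, so running it
  twice iterates the exponential. The factor 3 is an addition of three copies of the input.\<close>

lemma computable_double_exp: "computable (\<lambda>d. 2 ^ 2 ^ (3 * d + 9))"
proof -
  let ?p = "Seq (Assign ''x'' (Const 0) (Add (Add (var ''in'') (Add (var ''in'') (var ''in''))) (Const 9)))
    (Seq exp_com (Seq exp_com (Assign ''out'' (Const 0) (var ''x''))))"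
  have "\<exists>T. runs ?p ((\<lambda>a i. 0)(''in'' := (\<lambda>i. 0)(0 := n))) T (\<lambda>s. s ''out'' 0 = 2 ^ 2 ^ (3 * n + 9))" for n
  proof -
    let ?s = "(\<lambda>a i. 0)(''in'' := (\<lambda>i. 0)(0 := n)) :: mem"
    let ?s1 = "?s(''x'' := (?s ''x'')(0 := 3 * n + 9))"
    let ?T = "3 + 3 * 2 ^ (3 * n + 9) + 1"
    have out: "runs (Seq exp_com (Assign ''out'' (Const 0) (var ''x''))) s ?T (\<lambda>s. s ''out'' 0 = 2 ^ 2 ^ (3 * n + 9))"
      if "s ''x'' 0 = 2 ^ (3 * n + 9)" for s
      by (rule runs_Seq[where T' = 1], rule runs_conseq[OF runs_exp_com]) (use that in \<open>auto intro: runs_Assign\<close>)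
    have two: "runs (Seq exp_com (Seq exp_com (Assign ''out'' (Const 0) (var ''x'')))) ?s1
        (3 + 3 * (3 * n + 9) + ?T) (\<lambda>s. s ''out'' 0 = 2 ^ 2 ^ (3 * n + 9))"
      by (rule runs_Seq[where T' = ?T and T = "3 + 3 * (3 * n + 9)"], rule runs_conseq[OF runs_exp_com]) (use out in simp_all)
    have "runs ?p ?s (1 + (3 + 3 * (3 * n + 9) + ?T)) (\<lambda>s. s ''out'' 0 = 2 ^ 2 ^ (3 * n + 9))"
      by (rule runs_Seq[where T = 1 and T' = "3 + 3 * (3 * n + 9) + ?T"], rule runs_Assign) (use two in simp_all)
    then show ?thesis
      by blast
  qed
  then show ?thesis
    unfolding computable_def runs_def by meson
qed

theorem theorem2:
  shows "\<exists>(f :: nat \<Rightarrow> nat) (p :: com) (c :: nat). computable f \<and>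
    (\<forall>(n :: nat) (d :: nat) (G :: nat pair_pre_digraph) (X :: nat set).
       pair_graph G \<and> pverts G = {..<n} \<and> connected (with_proj G) \<and>
       X \<subseteq> pverts G \<and> card X = d \<and> threshold_graph (delete_verts G X) \<longrightarrow>
       (\<exists>t s. exec p (graph_input n G X) t s \<and> t \<le> f d * n ^ c \<and>
          cf_cn_coloring G (s ''k'' 0) (s ''col'') \<and>
          chi_cf G \<le> s ''k'' 0 \<and> s ''k'' 0 \<le> chi_cf G + 1))"
proof (rule exI[of _ "\<lambda>d. 2 ^ 2 ^ (3 * d + 9)"], rule exI[of _ main_com], rule exI[of _ 3],
    rule conjI[OF computable_double_exp], intro allI impI, elim conjE)
  fix n d and G :: "nat pair_pre_digraph" and X
  assume G: "pair_graph G" and V: "pverts G = {..<n}" and X: "X \<subseteq> pverts G" and d: "card X = d"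
    and thr: "threshold_graph (delete_verts G X)"
  \<comment> \<open>A threshold graph has a vertex, so \<open>n\<close> is positive, as the cubic
    estimate requires.\<close>
  obtain w where "dominates_outside G X w"
    using ex_dominates_outside[OF thr] by blast
  then have n: "0 < n"
    by (auto simp: dominates_outside_def V)
  obtain m where m: "m \<le> (d + 1) + 2 ^ (d + 1) * (d + 2)" "chi_cf G \<le> d + 2"
    and runs: "runs main_com (graph_input n G X) (main_time n (chi_cf G + 1) ((chi_cf G + 1) ^ m))
      (\<lambda>s. s ''k'' 0 \<le> chi_cf G + 1 \<and> cf_cn_coloring G (s ''k'' 0) (s ''col''))"
    using runs_main_com[OF G V X n thr] unfolding d by blast
  let ?P = "(chi_cf G + 1) ^ m"
  have "main_time n (chi_cf G + 1) ?P \<le> 133 * n ^ 3 * ((chi_cf G + 1 + 1) * (?P + 1) ^ 2)"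
    by (rule main_time_le[OF n])
  also have "\<dots> = 133 * ((chi_cf G + 1 + 1) * (?P + 1) ^ 2) * n ^ 3"
    by simp
  also have "\<dots> \<le> 2 ^ 2 ^ (3 * d + 9) * n ^ 3"
    using m by (intro mult_right_mono search_bound) auto
  finally have T: "main_time n (chi_cf G + 1) ?P \<le> 2 ^ 2 ^ (3 * d + 9) * n ^ 3" .
  obtain t s where "exec main_com (graph_input n G X) t s" "t \<le> main_time n (chi_cf G + 1) ?P"
      "s ''k'' 0 \<le> chi_cf G + 1" "cf_cn_coloring G (s ''k'' 0) (s ''col'')"
    using runs unfolding runs_def by blast
  then show "\<exists>t s. exec main_com (graph_input n G X) t s \<and> t \<le> 2 ^ 2 ^ (3 * d + 9) * n ^ 3 \<and>
      cf_cn_coloring G (s ''k'' 0) (s ''col'') \<and> chi_cf G \<le> s ''k'' 0 \<and> s ''k'' 0 \<le> chi_cf G + 1"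
    \<comment> \<open>The lower bound on the number of colors is the minimality of
      \<open>chi_cf G\<close>, applied to the coloring just found.\<close>
    using T chi_cf_le le_trans by blast
qed

end
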